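(* Let $q,a,b,\xi>0$ and let $\theta$ be a real-valued random variable such that, conditionally on a random variable $\kappa\in(0,1)$, $\theta\mid\kappa\sim \mathrm{EP}(\theta\mid q,\kappa)$, where $\kappa\sim \mathrm{G3B}(\kappa\mid a,b,\xi)$. Then the marginal density of $\theta$ is $$f(\theta\mid q,a,b,\xi)=\frac{\Gamma\left(a+\frac1q\right)}{\Gamma\left(\frac1q\right)}\,\frac{q}{2\,B(a,b)}\,\frac{\phi(q)}{\xi^{1/q}}\,\Psi\left(a+\tfrac1q,\;1+\tfrac1q-b,\;\frac{(\phi(q)\,|\theta|)^q}{\xi}\right)\qquad(\theta\in\mathbb{R}).$$
   Context: $\Gamma$ is the Gamma function, $B(a,b)$ the Beta function, and $\phi(q)=\sqrt{\Gamma(3/q)/\Gamma(1/q)}$. $\mathrm{EP}(x\mid q,\kappa)$ (Exponential Power), $q>0$, $\kappa\in(0,1)$, is the distribution on $\mathbb{R}$ with density $$\frac{q\,\phi(q)}{2\left(\frac1\kappa-1\right)^{1/q}\Gamma(1/q)}\exp\left(-\frac{\kappa\,(\phi(q)|x|)^q}{1-\kappa}\right).$$ $\mathrm{G3B}(x\mid a,b,\xi)$ (generalised three-parameter Beta), $a,b,\xi>0$, is the distribution on $(0,1)$ with density $$\frac{1}{B(a,b)}\,\frac{\xi^a x^{a-1}(1-x)^{b-1}}{(1-(1-\xi)x)^{a+b}}.$$ $\Psi(x,y,z)$ is the Tricomi confluent hypergeometric function, given for $y\notin\mathbb{Z}$ by $$\Psi(x,y,z)=\frac{\pi}{\sin(\pi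 y)}\left\{\frac{M(x,y,z)}{\Gamma(1+x-y)\Gamma(y)}-z^{1-y}\frac{M(1+x-y,2-y,z)}{\Gamma(x)\Gamma(2-y)}\right\},$$ with $M$ the Kummer confluent hypergeometric function; for integer $y$ it is defined by continuity in $y$, and its value at $z=0$ is the limit as $z\to0^+$ (possibly $+\infty$). *)

theory Defs
  imports "HOL-Probability.Probability"
begin

definition EP_scale :: "real \<Rightarrow> real" where
  "EP_scale q = sqrt (Gamma (3 / q) / Gamma (1 / q))"

definition EP_density :: "real \<Rightarrow> real \<Rightarrow> real \<Rightarrow> real" where
  "EP_density q \<kappa> x =
     q * EP_scale q / (2 * (1 / \<kappa> - 1) powr (1 / q) * Gamma (1 / q))
       * exp (- (\<kappa> * (EP_scale q * \<bar>x\<bar>) powr q / (1 - \<kappa>)))"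

definition EP :: "real \<Rightarrow> real \<Rightarrow> real measure" where
  "EP q \<kappa> = density lborel (\<lambda>x. ennreal (EP_density q \<kappa> x))"

definition G3B_density :: "real \<Rightarrow> real \<Rightarrow> real \<Rightarrow> real \<Rightarrow> real" where
  "G3B_density a b \<xi> x =
     (if 0 < x \<and> x < 1
      then 1 / Beta a b
             * (\<xi> powr a * x powr (a - 1) * (1 - x) powr (b - 1)
                 / (1 - (1 - \<xi>) * x) powr (a + b))
      else 0)"

definition kummer_M :: "real \<Rightarrow> real \<Rightarrow> real \<Rightarrow> real" where
  "kummer_M x y z = eval_fps (fps_hypergeo [x] [y] 1) z"

text \<open>The defining formula of the Tricomi function for non-integer \<open>y\<close> and \<open>z > 0\<close>.
  The entire function \<^const>\<open>rGamma\<close> is the reciprocal of \<^const>\<open>Gamma\<close>; it vanishes at the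
  poles of \<^const>\<open>Gamma\<close>.\<close>

definition tricomi_formula :: "real \<Rightarrow> real \<Rightarrow> real \<Rightarrow> real" where
  "tricomi_formula x y z =
     pi / sin (pi * y) *
       (kummer_M x y z * rGamma (1 + x - y) * rGamma y
        - z powr (1 - y) * (kummer_M (1 + x - y) (2 - y) z * rGamma x * rGamma (2 - y)))"

text \<open>The integers are isolated, so the limit at an integer \<open>y\<close> only involves the
  formula at non-integer arguments.\<close>

definition tricomi_pos :: "real \<Rightarrow> real \<Rightarrow> real \<Rightarrow> real" where
  "tricomi_pos x y z =
     (if y \<in> \<int> then Lim (at y) (\<lambda>t. tricomi_formula x t z) else tricomi_formula x y z)"

text \<open>The Tricomi function for \<open>z \<ge> 0\<close>. It is extended-real valued because the limit
  at \<open>z = 0\<close> may be \<open>\<infinity>\<close>.\<close>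

definition tricomi_Psi :: "real \<Rightarrow> real \<Rightarrow> real \<Rightarrow> ereal" where
  "tricomi_Psi x y z =
     (if z = 0 then Lim (at_right 0) (\<lambda>w. ereal (tricomi_pos x y w))
      else ereal (tricomi_pos x y z))"

text \<open>\<open>K (Y \<omega>)\<close> is a version of the conditional distribution of \<open>X\<close> given the
  sigma-algebra generated by \<open>Y\<close>.\<close>

definition cond_distributed ::
    "'w measure \<Rightarrow> ('w \<Rightarrow> real) \<Rightarrow> ('w \<Rightarrow> real) \<Rightarrow> (real \<Rightarrow> real measure) \<Rightarrow> bool" where
  "cond_distributed M X Y K \<longleftrightarrow>
     X \<in> borel_measurable M \<and> Y \<in> borel_measurable M \<and>
     (\<forall>A \<in> sets borel. AE \<omega> in M.
        real_cond_exp M (vimage_algebra (space M) Y borel) (indicator (X -` A \<inter> space M)) \<omega>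
          = measure (K (Y \<omega>)) A)"

definition EP_G3B_density :: "real \<Rightarrow> real \<Rightarrow> real \<Rightarrow> real \<Rightarrow> real \<Rightarrow> ereal" where
  "EP_G3B_density q a b \<xi> t =
     ereal (Gamma (a + 1 / q) / Gamma (1 / q) * (q / (2 * Beta a b)) * (EP_scale q / \<xi> powr (1 / q)))
       * tricomi_Psi (a + 1 / q) (1 + 1 / q - b) ((EP_scale q * \<bar>t\<bar>) powr q / \<xi>)"

end

theory Submission
  imports Defs "HOL-Real_Asymp.Real_Asymp"
begin

text \<open>
  The substitution \<open>\<kappa> = u / (u + \<xi>)\<close> turns the mixture integral into a multiple of
  \<open>\<integral> u powr (x - 1) * (1 + u) powr (y - x - 1) * exp (- z u) du\<close> over \<open>u > 0\<close>, with
  \<open>x = a + 1/q\<close>, \<open>y = 1 + 1/q - b\<close>, so everything rests on the Laplace integral representation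
  of the Tricomi function. Divided by \<open>Gamma x\<close>, this integral satisfies the same contiguous
  relations in \<open>(x, y)\<close> as the defining formula with Kummer functions; these imply Kummer's
  differential equation. For \<open>0 < y < 1\<close> the difference of the two solutions has vanishing
  initial data at \<open>0\<close>, so it is zero; the contiguous relations carry the identity to all
  non-integer \<open>y\<close>, and continuity in \<open>y\<close> and monotone behaviour as \<open>z\<close> decreases to \<open>0\<close> give
  the integer values of \<open>y\<close> and the (possibly infinite) value at \<open>z = 0\<close>.
\<close>

section \<open>Kummer functions and contiguous relations\<close>

text \<open>Kummer's equation is singular at the origin, so value and derivative there do not single
  out a solution. For \<open>0 < y < 1\<close> the exponents at the origin are 0 and
  \<open>1 - y\<close>, and the data that do single one out are the limits at 0 of the solution and
  of \<open>z powr y\<close> times its derivative; the second limit isolates the coefficient of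
  \<open>z powr (1 - y)\<close>. Outside this strip one of the two limits is in general infinite,
  which forces the detour through shifts of \<open>y\<close>. The relations are a property of a
  function of all three arguments, stable under differences. The formula, its two summands and the
  integral are thereby treated alike, and no second derivative has to be computed, because the
  derivative is again a multiple of a shifted member. At the origin of the real line the marginal
  density is infinite exactly when \<open>b \<le> 1/q\<close>, that is \<open>y \<ge> 1\<close>.
  This is why the mixture integral is carried in \<open>ennreal\<close> and the Tricomi function in
  \<open>ereal\<close>.\<close>

lemma pochhammer_nonzero_nonint:
  assumes "(y::real) \<notin> \<int>"
  shows "pochhammer y n \<noteq> 0"
  using assms by (auto simp: pochhammer_eq_0_iff)

lemma nonint_shift:
  assumes "(y::real) \<notin> \<int>"
  shows "y + 1 \<notin> \<int>" "y - 1 \<notin> \<int>" "2 - y \<notin> \<int>" "1 - y \<notin> \<int>" "y \<noteq> 0" "1 - y \<noteq> 0" "y - 1 \<noteq> 0"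
proof -
  show "y + 1 \<notin> \<int>" using assms Ints_diff[of "y+1" 1] by auto
  show *: "y - 1 \<notin> \<int>" using assms Ints_add[of "y-1" 1] by auto
  show "2 - y \<notin> \<int>" using assms Ints_diff[of 2 "2-y"] by auto
  show "1 - y \<notin> \<int>" using assms Ints_diff[of 1 "1-y"] by auto
  show "y \<noteq> 0" "1 - y \<noteq> 0" "y - 1 \<noteq> 0" using assms * by auto
qed

abbreviation kummer_fps :: "real \<Rightarrow> real \<Rightarrow> real fps" where
  "kummer_fps x y \<equiv> fps_hypergeo [x] [y] 1"

lemma kummer_fps_nth: "fps_nth (kummer_fps x y) n = pochhammer x n / (pochhammer y n * fact n)"
  by (simp add: mult.commute)

text \<open>The ratio of consecutive terms is \<open>(x + n) * z / ((y + n) * (n + 1))\<close>,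
  which tends to 0; \<open>y\<close> being no integer keeps the denominators nonzero.\<close>

lemma kummer_fps_conv_radius:
  assumes "y \<notin> \<int>"
  shows "fps_conv_radius (kummer_fps x y) = \<infinity>"
  unfolding fps_conv_radius_def
proof (rule conv_radius_inftyI'')
  fix z :: real
  let ?f = "\<lambda>n. fps_nth (kummer_fps x y) n * z ^ n"
  have "((\<lambda>n. \<bar>(x + real n) * z / ((y + real n) * (real n + 1))\<bar>) \<longlongrightarrow> 0) at_top"
  proof -
    have "(\<lambda>n. (x + real n) / ((y + real n) * (real n + 1))) \<longlonglongrightarrow> 0"
      by real_asymp
    from tendsto_rabs_zero[OF tendsto_mult_left_zero[OF this, of z]] show ?thesis
      by simp
  qed
  hence "eventually (\<lambda>n. \<bar>(x + real n) * z / ((y + real n) * (real n + 1))\<bar> < 1/2) at_top"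
    by (rule order_tendstoD) simp
  then obtain N where N: "\<And>n. n \<ge> N \<Longrightarrow> \<bar>(x + real n) * z / ((y + real n) * (real n + 1))\<bar> < 1/2"
    by (auto simp: eventually_at_top_linorder)
  show "summable ?f"
  proof (rule summable_ratio_test)
    fix n assume n: "n \<ge> N"
    have nz: "y + real n \<noteq> 0"
      using assms by (metis Ints_minus Ints_of_nat add_eq_0_iff minus_minus)
    have "?f (Suc n) = ((x + real n) * z / ((y + real n) * (real n + 1))) * ?f n"
      using nz pochhammer_nonzero_nonint[OF assms, of n]
      unfolding kummer_fps_nth pochhammer_Suc fact_Suc by (simp add: field_simps)
    hence "norm (?f (Suc n)) = \<bar>(x + real n) * z / ((y + real n) * (real n + 1))\<bar> * norm (?f n)"
      by (simp only: real_norm_def abs_mult)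
    also have "\<dots> \<le> 1/2 * norm (?f n)"
      using N[OF n] by (intro mult_right_mono) auto
    finally show "norm (?f (Suc n)) \<le> 1/2 * norm (?f n)" .
  qed simp
qed

text \<open>In the coefficient of index \<open>m + 1\<close> the two Pochhammer products differ only
  by the factors \<open>x + 1 + m\<close> and \<open>x\<close>; their difference
  \<open>m + 1\<close> cancels against the factorial.\<close>

lemma kummer_fps_contig_up:
  assumes "y \<notin> \<int>"
  shows "fps_const y * kummer_fps (x + 1) y - fps_const y * kummer_fps x y
           = fps_X * kummer_fps (x + 1) (y + 1)"
proof (rule fps_ext)
  fix n
  show "fps_nth (fps_const y * kummer_fps (x + 1) y - fps_const y * kummer_fps x y) n
          = fps_nth (fps_X * kummer_fps (x + 1) (y + 1)) n"
  proof (cases n)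
    case (Suc m)
    have nz: "y \<noteq> 0" "pochhammer (y + 1) m \<noteq> 0"
      using nonint_shift[OF assms] pochhammer_nonzero_nonint by auto
    have 1: "pochhammer (x + 1) (Suc m) = pochhammer (x + 1) m * (x + 1 + m)"
      and 2: "pochhammer x (Suc m) = x * pochhammer (x + 1) m"
      and 3: "pochhammer y (Suc m) = y * pochhammer (y + 1) m"
      by (rule pochhammer_Suc pochhammer_rec)+
    have "y * (p * (x + 1 + m) / (y * r * (real (Suc m) * f))) - y * (x * p / (y * r * (real (Suc m) * f)))
            = p / (r * f)" if "r \<noteq> 0" "f \<noteq> 0" for p r f :: real
      using that nz by (simp add: divide_simps) (simp add: algebra_simps)
    from this[OF nz(2), of "fact m"]
    show ?thesis unfolding Suc fps_mult_left_const_nth fps_sub_nth fps_X_mult_nth kummer_fps_nth 1 2 3 fact_Suc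
      by simp
  qed simp
qed

text \<open>Coefficientwise this is \<open>y - 1 + n = (x + n) - (x - y + 1)\<close>, with the
  factors \<open>y - 1 + n\<close> and \<open>x + n\<close> absorbed by shifting the Pochhammer
  symbols.\<close>

lemma kummer_fps_contig_down:
  assumes "y \<notin> \<int>"
  shows "fps_const (y - 1) * kummer_fps x (y - 1)
           = fps_const x * kummer_fps (x + 1) y - fps_const (x - y + 1) * kummer_fps x y"
proof (rule fps_ext)
  fix n
  have nz: "y - 1 \<noteq> 0" "pochhammer (y - 1) n \<noteq> 0" "pochhammer y n \<noteq> 0"
    using nonint_shift[OF assms] assms pochhammer_nonzero_nonint by auto
  have 1: "x * pochhammer (x + 1) n = pochhammer x n * (x + n)"
    by (metis pochhammer_Suc pochhammer_rec)
  have 2: "(y - 1) * pochhammer y n = pochhammer (y - 1) n * (y - 1 + n)"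
    by (metis pochhammer_Suc pochhammer_rec diff_add_cancel)
  have 3: "(y - 1) / pochhammer (y - 1) n = (y - 1 + n) / pochhammer y n"
    using nz 2 by (simp add: field_simps)
  have "(y - 1) * (pochhammer x n / (pochhammer (y - 1) n * fact n)) 
      = ((y - 1) / pochhammer (y - 1) n) * pochhammer x n / fact n"
    by simp
  also have "\<dots> = (pochhammer x n * (x + n) - (x - y + 1) * pochhammer x n) / (pochhammer y n * fact n)"
    unfolding 3 by (simp add: algebra_simps)
  also have "\<dots> = x * (pochhammer (x + 1) n / (pochhammer y n * fact n))
         - (x - y + 1) * (pochhammer x n / (pochhammer y n * fact n))"
    unfolding 1[symmetric] by (simp add: diff_divide_distrib)
  finally show "fps_nth (fps_const (y - 1) * kummer_fps x (y - 1)) n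
          = fps_nth (fps_const x * kummer_fps (x + 1) y - fps_const (x - y + 1) * kummer_fps x y) n"
    unfolding fps_mult_left_const_nth fps_sub_nth kummer_fps_nth .
qed

lemma kummer_fps_deriv:
  assumes "y \<notin> \<int>"
  shows "fps_deriv (kummer_fps x y) = fps_const (x / y) * kummer_fps (x + 1) (y + 1)"
proof (rule fps_ext)
  fix n
  have nz: "y \<noteq> 0" "pochhammer (y + 1) n \<noteq> 0"
    using nonint_shift[OF assms] pochhammer_nonzero_nonint by auto
  have "real (n + 1) * (x * p / (y * r * (real (Suc n) * f))) = x / y * (p / (r * f))" for p r f
    by (simp add: divide_simps)
  thus "fps_nth (fps_deriv (kummer_fps x y)) n = fps_nth (fps_const (x / y) * kummer_fps (x + 1) (y + 1)) n"
    unfolding fps_deriv_nth fps_mult_left_const_nth kummer_fps_nth Suc_eq_plus1[symmetric] pochhammer_rec fact_Suc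
    by simp
qed

lemma eval_kummer_fps_const_mult:
  assumes "y \<notin> \<int>"
  shows "eval_fps (fps_const c * kummer_fps x y) z = c * kummer_M x y z"
  using kummer_fps_conv_radius[OF assms]
  by (subst eval_fps_mult) (auto simp: kummer_M_def)

lemma conv_radius_const_kummer_fps:
  assumes "y \<notin> \<int>"
  shows "fps_conv_radius (fps_const c * kummer_fps x y) = \<infinity>"
  using fps_conv_radius_mult[of "fps_const c" "kummer_fps x y"] kummer_fps_conv_radius[OF assms]
  by simp

lemma kummer_M_contig_up:
  assumes "y \<notin> \<int>"
  shows "z * kummer_M (x + 1) (y + 1) z = y * kummer_M (x + 1) y z - y * kummer_M x y z"
proof -
  have "z * kummer_M (x + 1) (y + 1) z = eval_fps (fps_X * kummer_fps (x + 1) (y + 1)) z"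
    using kummer_fps_conv_radius[OF nonint_shift(1)[OF assms]]
    by (subst eval_fps_mult) (auto simp: kummer_M_def)
  also have "\<dots> = y * kummer_M (x + 1) y z - y * kummer_M x y z"
    unfolding kummer_fps_contig_up[OF assms, symmetric]
    by (subst eval_fps_diff)
       (use assms in \<open>simp_all add: eval_kummer_fps_const_mult conv_radius_const_kummer_fps\<close>)
  finally show ?thesis .
qed

lemma kummer_M_contig_down:
  assumes "y \<notin> \<int>"
  shows "(y - 1) * kummer_M x (y - 1) z = x * kummer_M (x + 1) y z - (x - y + 1) * kummer_M x y z"
proof -
  have "(y - 1) * kummer_M x (y - 1) z = eval_fps (fps_const (y - 1) * kummer_fps x (y - 1)) z"
    using assms nonint_shift by (simp add: eval_kummer_fps_const_mult)
  also have "\<dots> = x * kummer_M (x + 1) y z - (x - y + 1) * kummer_M x y z"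
    unfolding kummer_fps_contig_down[OF assms]
    by (subst eval_fps_diff)
       (use assms in \<open>simp_all add: eval_kummer_fps_const_mult conv_radius_const_kummer_fps\<close>)
  finally show ?thesis .
qed

lemma kummer_M_has_deriv:
  assumes "y \<notin> \<int>"
  shows "(kummer_M x y has_real_derivative x / y * kummer_M (x + 1) (y + 1) z) (at z)"
proof -
  have "(eval_fps (kummer_fps x y) has_real_derivative eval_fps (fps_deriv (kummer_fps x y)) z) (at z)"
    by (rule has_field_derivative_eval_fps) (simp add: kummer_fps_conv_radius[OF assms])
  thus ?thesis
    using nonint_shift[OF assms]
    unfolding kummer_fps_deriv[OF assms] by (simp add: eval_kummer_fps_const_mult kummer_M_def[abs_def])
qed

lemma kummer_M_0 [simp]: "kummer_M x y 0 = 1"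
  by (simp add: kummer_M_def eval_fps_at_0)

lemma kummer_M_tendsto_0:
  assumes "y \<notin> \<int>"
  shows "(kummer_M x y \<longlongrightarrow> 1) (at_right 0)"
  using DERIV_isCont[OF kummer_M_has_deriv[OF assms, of x 0]]
  by (simp add: isCont_def filterlim_at_split)

lemma kummer_M_pos:
  assumes "x > 0" "y > 0" "y \<notin> \<int>" "z > 0"
  shows "kummer_M x y z > 0"
proof -
  have s: "summable (\<lambda>n. fps_nth (kummer_fps x y) n * z ^ n)"
    by (rule summable_fps) (simp add: kummer_fps_conv_radius[OF assms(3)])
  have "0 < (\<Sum>n. fps_nth (kummer_fps x y) n * z ^ n)"
    unfolding kummer_fps_nth using assms s[unfolded kummer_fps_nth]
    by (intro suminf_pos) (auto intro!: mult_pos_pos divide_pos_pos pochhammer_pos)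
  thus ?thesis by (simp add: kummer_M_def eval_fps_def)
qed

text \<open>This and \<open>tricomi_sol2\<close> are the Frobenius solutions at 0 for the exponents
  0 and \<open>1 - y\<close>. The factors depending on \<open>x\<close> and \<open>y\<close> are
  kept inside, so that each summand satisfies the contiguous relations by itself and not merely the
  differential equation.\<close>

definition tricomi_sol1 :: "real \<Rightarrow> real \<Rightarrow> real \<Rightarrow> real" where
  "tricomi_sol1 x y z = pi / sin (pi * y) * (kummer_M x y z * rGamma (1 + x - y) * rGamma y)"

definition tricomi_sol2 :: "real \<Rightarrow> real \<Rightarrow> real \<Rightarrow> real" where
  "tricomi_sol2 x y z = pi / sin (pi * y) *
     (z powr (1 - y) * (kummer_M (1 + x - y) (2 - y) z * rGamma x * rGamma (2 - y)))"

lemma tricomi_formula_eq: "tricomi_formula x y z = tricomi_sol1 x y z - tricomi_sol2 x y z"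
  by (simp add: tricomi_formula_def tricomi_sol1_def tricomi_sol2_def right_diff_distrib)

text \<open>DLMF 13.3.9, 13.3.10 and 13.3.22; together they imply Kummer's differential equation.\<close>

definition tricomi_family :: "(real \<Rightarrow> real \<Rightarrow> real \<Rightarrow> real) \<Rightarrow> bool" where
  "tricomi_family F \<longleftrightarrow> (\<forall>x y z. x > 0 \<longrightarrow> y \<notin> \<int> \<longrightarrow> z > 0 \<longrightarrow>
     F x (y - 1) z = F x y z - x * F (x + 1) y z \<and>
     z * F (x + 1) (y + 1) z = (y - x - 1) * F (x + 1) y z + F x y z \<and>
     (F x y has_real_derivative - x * F (x + 1) (y + 1) z) (at z))"

lemma sin_pi_shift: "sin (pi * (y + 1)) = - sin (pi * y)" "sin (pi * (y - 1)) = - sin (pi * y)"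
  by (simp_all add: algebra_simps)

text \<open>A unit shift of \<open>y\<close> flips the sign of the sine, and every
  \<open>rGamma\<close> is reduced to \<open>g\<close> or \<open>h\<close> by the functional
  equation, which has no division and so also holds at the poles of Gamma. What remains are the two
  contiguous relations of \<open>kummer_M\<close>.\<close>

lemma tricomi_family_sol1: "tricomi_family tricomi_sol1"
  unfolding tricomi_family_def
proof (intro allI impI)
  fix x y z :: real assume x: "x > 0" and y: "y \<notin> \<int>" and z: "z > 0"
  note ny = nonint_shift[OF y]
  define c where "c = pi / sin (pi * y)"
  have cp: "pi / sin (pi * (y + 1)) = - c" "pi / sin (pi * (y - 1)) = - c"
    by (simp_all add: sin_pi_shift c_def)
  define g where "g = rGamma (2 + x - y)"
  define h where "h = rGamma (y + 1)"
  have g1: "rGamma (1 + x - y) = (1 + x - y) * g"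
    using rGamma_plus1[of "1 + x - y"] by (simp add: g_def algebra_simps)
  have h0: "rGamma y = y * h" using rGamma_plus1[of y] by (simp add: h_def)
  have h1: "rGamma (y - 1) = (y - 1) * y * h" using rGamma_plus1[of "y - 1"] by (simp add: h0)
  have e: "1 + x - (y - 1) = 2 + x - y" "1 + (x + 1) - y = 2 + x - y"
     "1 + (x + 1) - (y + 1) = 1 + x - y" by simp_all
  note defs = tricomi_sol1_def e cp c_def[symmetric] g_def[symmetric] h_def[symmetric] g1 h0 h1
  note d = kummer_M_contig_down[OF y, of x z]
  note u = kummer_M_contig_up[OF y, of z x]
  have 1: "tricomi_sol1 x (y - 1) z = tricomi_sol1 x y z - x * tricomi_sol1 (x + 1) y z"
  proof -
    have "tricomi_sol1 x (y - 1) z = - c * g * y * h * ((y - 1) * kummer_M x (y - 1) z)"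
      unfolding defs by (simp add: algebra_simps)
    also have "\<dots> = tricomi_sol1 x y z - x * tricomi_sol1 (x + 1) y z"
      unfolding defs d by (simp add: algebra_simps)
    finally show ?thesis .
  qed
  have 2: "z * tricomi_sol1 (x + 1) (y + 1) z
             = (y - x - 1) * tricomi_sol1 (x + 1) y z + tricomi_sol1 x y z"
  proof -
    have "z * tricomi_sol1 (x + 1) (y + 1) z
            = - c * (1 + x - y) * g * h * (z * kummer_M (x + 1) (y + 1) z)"
      unfolding defs by (simp add: algebra_simps)
    also have "\<dots> = (y - x - 1) * tricomi_sol1 (x + 1) y z + tricomi_sol1 x y z"
      unfolding defs u by (simp add: algebra_simps)
    finally show ?thesis .
  qed
  have "(tricomi_sol1 x y has_real_derivative
           c * (x / y * kummer_M (x + 1) (y + 1) z * ((1 + x - y) * g) * (y * h))) (at z)"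
    unfolding defs
    by (rule DERIV_cmult DERIV_cmult_right kummer_M_has_deriv[OF y])+
  also have "c * (x / y * kummer_M (x + 1) (y + 1) z * ((1 + x - y) * g) * (y * h))
      = - x * tricomi_sol1 (x + 1) (y + 1) z"
    unfolding defs using ny by (simp add: field_simps)
  finally show "tricomi_sol1 x (y - 1) z = tricomi_sol1 x y z - x * tricomi_sol1 (x + 1) y z \<and>
     z * tricomi_sol1 (x + 1) (y + 1) z = (y - x - 1) * tricomi_sol1 (x + 1) y z + tricomi_sol1 x y z \<and>
     (tricomi_sol1 x y has_real_derivative - x * tricomi_sol1 (x + 1) (y + 1) z) (at z)"
    using 1 2 by blast
qed

text \<open>Supplies the derivative of \<open>tricomi_sol2\<close>. After the product rule, the
  upward relation removes \<open>z * kummer_M (x + 1) (y + 1) z\<close>, and the downward relation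
  collects the rest into a single term.\<close>

lemma kummer_M_powr_has_deriv:
  assumes "y \<notin> \<int>" "z > 0"
  shows "((\<lambda>z. z powr (y - 1) * kummer_M x y z) has_real_derivative
           (y - 1) * (z powr (y - 2) * kummer_M x (y - 1) z)) (at z)"
proof -
  have "((\<lambda>z. z powr (y - 1) * kummer_M x y z) has_real_derivative
      ((y - 1) * z powr (y - 1 - 1)) * kummer_M x y z
        + (x / y * kummer_M (x + 1) (y + 1) z) * z powr (y - 1)) (at z)"
    using assms by (intro DERIV_mult kummer_M_has_deriv has_real_derivative_powr)
  also have "z powr (y - 1) = z * z powr (y - 2)"
    using assms by (simp add: powr_mult_base)
  also have "((y - 1) * z powr (y - 1 - 1)) * kummer_M x y z
        + (x / y * kummer_M (x + 1) (y + 1) z) * (z * z powr (y - 2))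
      = z powr (y - 2) * ((y - 1) * kummer_M x y z + x / y * (z * kummer_M (x + 1) (y + 1) z))"
    by (simp add: algebra_simps)
  also have "(y - 1) * kummer_M x y z + x / y * (z * kummer_M (x + 1) (y + 1) z)
      = (y - 1) * kummer_M x (y - 1) z"
    unfolding kummer_M_contig_up[OF assms(1)] kummer_M_contig_down[OF assms(1)]
    using nonint_shift[OF assms(1)] by (simp add: field_simps)
  finally show ?thesis by (simp add: mult_ac)
qed

text \<open>Written in the Kummer parameters \<open>A = 1 + x - y\<close> and
  \<open>B = 2 - y\<close>. Since \<open>B\<close> falls as \<open>y\<close> rises, the upward and
  downward relations swap the roles they have for \<open>tricomi_sol1\<close>.\<close>

lemma tricomi_family_sol2: "tricomi_family tricomi_sol2"
  unfolding tricomi_family_def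
proof (intro allI impI)
  fix x y z :: real assume x: "x > 0" and y: "y \<notin> \<int>" and z: "z > 0"
  note ny = nonint_shift[OF y]
  define A where "A = 1 + x - y"
  define B where "B = 2 - y"
  have B: "B \<notin> \<int>" using ny by (simp add: B_def)
  define c where "c = pi / sin (pi * y)"
  have cp: "pi / sin (pi * (y + 1)) = - c" "pi / sin (pi * (y - 1)) = - c"
    by (simp_all add: sin_pi_shift c_def)
  define p where "p = z powr (- y)"
  have p: "z powr (1 - y) = z * p" "z powr (1 - (y - 1)) = z * (z * p)" "z powr (1 - (y + 1)) = p"
    using z by (simp_all add: p_def powr_mult_base)
  define g where "g = rGamma (x + 1)"
  define h where "h = rGamma (3 - y)"
  have g: "rGamma x = x * g"
    using rGamma_plus1[of x] by (simp add: g_def algebra_simps)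
  have h0: "rGamma (2 - y) = (2 - y) * h" using rGamma_plus1[of "2 - y"] by (simp add: h_def)
  have h1: "rGamma (1 - y) = (1 - y) * (2 - y) * h" using rGamma_plus1[of "1 - y"] by (simp add: h0)
  have e: "1 + x - (y - 1) = A + 1" "1 + (x + 1) - y = A + 1" "2 - (y - 1) = B + 1" 
     "1 + (x + 1) - (y + 1) = A" "2 - (y + 1) = B - 1" "1 + x - y = A" by (simp_all add: A_def B_def)
  have e2: "rGamma (B + 1) = h" "rGamma (B - 1) = (B - 1) * B * h" "rGamma B = B * h"
    using h0 h1 by (simp_all add: B_def h_def algebra_simps)
  note defs = tricomi_sol2_def e B_def[symmetric] e2 cp c_def[symmetric] g_def[symmetric] p g
  note d = kummer_M_contig_down[OF B, of A z]
  note u = kummer_M_contig_up[OF B, of z A]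
  have 1: "tricomi_sol2 x (y - 1) z = tricomi_sol2 x y z - x * tricomi_sol2 (x + 1) y z"
  proof -
    have "tricomi_sol2 x (y - 1) z = - c * z * p * x * g * h * (z * kummer_M (A + 1) (B + 1) z)"
      unfolding defs by (simp add: algebra_simps)
    also have "\<dots> = tricomi_sol2 x y z - x * tricomi_sol2 (x + 1) y z"
      unfolding defs u by (simp add: algebra_simps)
    finally show ?thesis .
  qed
  have 2: "z * tricomi_sol2 (x + 1) (y + 1) z
             = (y - x - 1) * tricomi_sol2 (x + 1) y z + tricomi_sol2 x y z"
  proof -
    have xy: "y = 2 - B" "x = A - B + 1" by (simp_all add: A_def B_def)
    have "z * tricomi_sol2 (x + 1) (y + 1) z
            = - c * z * p * g * B * h * ((B - 1) * kummer_M A (B - 1) z)"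
      unfolding defs by (simp add: algebra_simps)
    also have "\<dots> = (y - x - 1) * tricomi_sol2 (x + 1) y z + tricomi_sol2 x y z"
      unfolding defs d unfolding xy by (simp add: algebra_simps)
    finally show ?thesis .
  qed
  have s: "tricomi_sol2 x y = (\<lambda>z. c * (rGamma x * rGamma B) * (z powr (B - 1) * kummer_M A B z))"
    by (auto simp: tricomi_sol2_def A_def B_def c_def)
  have "(tricomi_sol2 x y has_real_derivative
           c * (rGamma x * rGamma B) * ((B - 1) * (z powr (B - 2) * kummer_M A (B - 1) z))) (at z)"
    unfolding s using B z by (intro DERIV_cmult kummer_M_powr_has_deriv)
  also have "c * (rGamma x * rGamma B) * ((B - 1) * (z powr (B - 2) * kummer_M A (B - 1) z))
      = - x * tricomi_sol2 (x + 1) (y + 1) z"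
  proof -
    have "z powr (B - 2) = p" by (simp add: B_def p_def)
    thus ?thesis unfolding defs by (simp add: algebra_simps)
  qed
  finally show "tricomi_sol2 x (y - 1) z = tricomi_sol2 x y z - x * tricomi_sol2 (x + 1) y z \<and>
     z * tricomi_sol2 (x + 1) (y + 1) z = (y - x - 1) * tricomi_sol2 (x + 1) y z + tricomi_sol2 x y z \<and>
     (tricomi_sol2 x y has_real_derivative - x * tricomi_sol2 (x + 1) (y + 1) z) (at z)"
    using 1 2 by blast
qed

lemma tricomi_family_diff:
  assumes "tricomi_family F" "tricomi_family G"
  shows "tricomi_family (\<lambda>x y z. F x y z - G x y z)"
  unfolding tricomi_family_def
proof (intro allI impI conjI)
  fix x y z :: real assume x: "x > 0" and y: "y \<notin> \<int>" and z: "z > 0"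
  note F = assms(1)[unfolded tricomi_family_def, rule_format, OF x y z]
  note G = assms(2)[unfolded tricomi_family_def, rule_format, OF x y z]
  show "F x (y - 1) z - G x (y - 1) z = F x y z - G x y z - x * (F (x + 1) y z - G (x + 1) y z)"
    using F G by (simp add: algebra_simps)
  show "z * (F (x + 1) (y + 1) z - G (x + 1) (y + 1) z)
      = (y - x - 1) * (F (x + 1) y z - G (x + 1) y z) + (F x y z - G x y z)"
    using F G by (simp add: right_diff_distrib)
  have "((\<lambda>z. F x y z - G x y z) has_real_derivative
          (- x * F (x + 1) (y + 1) z) - (- x * G (x + 1) (y + 1) z)) (at z)"
    using F G by (intro DERIV_diff) auto
  thus "((\<lambda>z. F x y z - G x y z) has_real_derivative
          - x * (F (x + 1) (y + 1) z - G (x + 1) (y + 1) z)) (at z)"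
    by (simp add: algebra_simps)
qed

lemma tricomi_family_tricomi_formula: "tricomi_family tricomi_formula"
  using tricomi_family_diff[OF tricomi_family_sol1 tricomi_family_sol2]
  by (simp add: tricomi_formula_eq[abs_def])

section \<open>Uniqueness for Kummer's equation\<close>

lemma tricomi_familyD:
  assumes "tricomi_family F" "x > 0" "y \<notin> \<int>" "z > 0"
  shows "F x (y - 1) z = F x y z - x * F (x + 1) y z"
    and "z * F (x + 1) (y + 1) z = (y - x - 1) * F (x + 1) y z + F x y z"
    and "(F x y has_real_derivative - x * F (x + 1) (y + 1) z) (at z)"
  using assms unfolding tricomi_family_def by blast+

text \<open>This is Kummer's equation \<open>z F'' + (y - z) F' - x F = 0\<close> divided by
  \<open>x\<close>: by the derivative rule \<open>F'\<close> is
  \<open>- x * F (x + 1) (y + 1) z\<close> and \<open>F''\<close> is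
  \<open>x * (x + 1) * F (x + 2) (y + 2) z\<close>.\<close>

lemma tricomi_family_ode:
  assumes F: "tricomi_family F" and x: "x > 0" and y: "y \<notin> \<int>" and z: "z > 0"
  shows "z * ((x + 1) * F (x + 2) (y + 2) z) = (y - z) * F (x + 1) (y + 1) z + F x y z"
proof -
  note y1 = nonint_shift(1)[OF y]
  have a: "F (x + 1) y z = F (x + 1) (y + 1) z - (x + 1) * F (x + 2) (y + 1) z"
    using tricomi_familyD(1)[OF F _ y1 z, of "x + 1"] x by (simp add: algebra_simps)
  have b: "z * F (x + 2) (y + 2) z = (y - x - 1) * F (x + 2) (y + 1) z + F (x + 1) (y + 1) z"
    using tricomi_familyD(2)[OF F _ y1 z, of "x + 1"] x by (simp add: algebra_simps)
  have c: "z * F (x + 1) (y + 1) z = (y - x - 1) * F (x + 1) y z + F x y z"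
    by (rule tricomi_familyD(2)[OF F x y z])
  have "z * ((x + 1) * F (x + 2) (y + 2) z) = (x + 1) * (z * F (x + 2) (y + 2) z)"
    by simp
  also have "\<dots> = (y - x - 1) * ((x + 1) * F (x + 2) (y + 1) z) + (x + 1) * F (x + 1) (y + 1) z"
    unfolding b by (simp add: algebra_simps)
  also have "(x + 1) * F (x + 2) (y + 1) z = F (x + 1) (y + 1) z - F (x + 1) y z"
    using a by simp
  also have "(y - x - 1) * (F (x + 1) (y + 1) z - F (x + 1) y z) + (x + 1) * F (x + 1) (y + 1) z
      = (y - z) * F (x + 1) (y + 1) z + F x y z"
    using c by (simp add: algebra_simps)
  finally show ?thesis .
qed

lemma nonint_strip: "0 < y \<Longrightarrow> y < (1::real) \<Longrightarrow> y \<notin> \<int>"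
  using Ints_nonzero_abs_ge1[of y] by auto

lemma sin_pi_strip_pos: "0 < y \<Longrightarrow> y < (1::real) \<Longrightarrow> sin (pi * y) > 0"
  by (intro sin_gt_zero) auto

lemma tendsto_powr_0_at_right: "a > 0 \<Longrightarrow> ((\<lambda>z::real. z powr a) \<longlongrightarrow> 0) (at_right 0)"
  by real_asymp

lemma rGamma_real_pos: "x > 0 \<Longrightarrow> rGamma (x::real) > 0"
  by (simp add: rGamma_inverse_Gamma Gamma_real_pos)

lemma tricomi_sol1_tendsto_0:
  assumes "y \<notin> \<int>"
  shows "(tricomi_sol1 x y \<longlongrightarrow> pi / sin (pi * y) * (rGamma (1 + x - y) * rGamma y)) (at_right 0)"
  unfolding tricomi_sol1_def[abs_def]
  using tendsto_mult_left[OF tendsto_mult_right[OF tendsto_mult_right[OF kummer_M_tendsto_0[OF assms, of x],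
     of "rGamma (1 + x - y)"], of "rGamma y"], of "pi / sin (pi * y)"] by simp

text \<open>By Kummer's equation the Wronskian of \<open>F\<close> and the positive solution
  \<^const>\<open>tricomi_sol1\<close> is a multiple of \<open>z powr (- y) * exp z\<close>.\<close>

lemma tricomi_family_unique_strip:
  assumes F: "tricomi_family F" and x: "x > 0" and y: "0 < y" "y < 1"
    and lim0: "(F x y \<longlongrightarrow> 0) (at_right 0)"
    and lim1: "((\<lambda>z. z powr y * F (x + 1) (y + 1) z) \<longlongrightarrow> 0) (at_right 0)"
    and z: "z > 0"
  shows "F x y z = 0"
proof -
  have yn: "y \<notin> \<int>" using y by (rule nonint_strip)
  have yn1: "y + 1 \<notin> \<int>" by (rule nonint_shift[OF yn])
  define G where "G = tricomi_sol1"
  have G: "tricomi_family G" unfolding G_def by (rule tricomi_family_sol1)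
  define K where "K = pi / sin (pi * y) * (rGamma (1 + x - y) * rGamma y)"
  have limG0: "(G x y \<longlongrightarrow> K) (at_right 0)"
    unfolding G_def K_def by (rule tricomi_sol1_tendsto_0[OF yn])
  obtain L where limG1: "(G (x + 1) (y + 1) \<longlongrightarrow> L) (at_right 0)"
    unfolding G_def using tricomi_sol1_tendsto_0[OF yn1] by blast
  have K: "K > 0" unfolding K_def using x y sin_pi_strip_pos[OF y]
    by (intro mult_pos_pos divide_pos_pos rGamma_real_pos) auto
  have Gpos: "G x y s > 0" if "s > 0" for s
    unfolding G_def tricomi_sol1_def using x y sin_pi_strip_pos[OF y] kummer_M_pos[OF x y(1) yn that]
    by (intro mult_pos_pos divide_pos_pos rGamma_real_pos) auto
  \<comment> \<open>Up to the factor \<open>1/x\<close> this is the Wronskian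
    \<open>F G' - F' G\<close> times Abel's integrating factor \<open>s powr y * exp (-s)\<close>,
    so it is constant. The power is attached to the derivative terms because only these products
    need have limits at 0.\<close>
  define W where "W s = exp (-s) * ((s powr y * F (x + 1) (y + 1) s) * G x y s
         - F x y s * (s powr y * G (x + 1) (y + 1) s))" for s
  have e0: "((\<lambda>s::real. exp (-s)) \<longlongrightarrow> 1) (at_right 0)" by real_asymp
  have "(W \<longlongrightarrow> 1 * (0 * K - 0 * (0 * L))) (at_right 0)"
    unfolding W_def
    by (intro tendsto_mult tendsto_diff e0 lim0 lim1 limG0 limG1 tendsto_powr_0_at_right y)
  hence W0: "(W \<longlongrightarrow> 0) (at_right 0)" by simp
  have D0: "(H x y has_real_derivative - x * H (x + 1) (y + 1) s) (at s)"
    and D1: "(H (x + 1) (y + 1) has_real_derivative - (x + 1) * H (x + 2) (y + 2) s) (at s)"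
    if "tricomi_family H" "s > 0" for H s
    using tricomi_familyD(3)[OF that(1) x yn that(2)] tricomi_familyD(3)[OF that(1) _ yn1 that(2), of "x+1"] x
    by (simp_all add: algebra_simps)
  have Wderiv: "(W has_real_derivative 0) (at s)" if s: "s > 0" for s
  proof -
    define f0 f1 f2 g0 g1 g2 where fg: "f0 = F x y s" "f1 = F (x + 1) (y + 1) s" "f2 = F (x + 2) (y + 2) s"
      "g0 = G x y s" "g1 = G (x + 1) (y + 1) s" "g2 = G (x + 2) (y + 2) s"
    have oF: "s * ((x + 1) * f2) = (y - s) * f1 + f0" and oG: "s * ((x + 1) * g2) = (y - s) * g1 + g0"
      unfolding fg by (rule tricomi_family_ode[OF F x yn s] tricomi_family_ode[OF G x yn s])+
    have W_eq: "W = (\<lambda>s. (exp (-s) * s powr y) * (F (x + 1) (y + 1) s * G x y s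
         - F x y s * G (x + 1) (y + 1) s))"
      by (auto simp: W_def algebra_simps)
    define p where "p = s powr (y - 1)"
    have p: "s powr y = s * p" using s by (simp add: p_def powr_mult_base)
    have Dp: "((\<lambda>s. exp (-s) * s powr y) has_real_derivative exp (-s) * p * (y - s)) (at s)"
      by (rule derivative_eq_intros DERIV_fun_exp s refl | (simp add: s; fail))+
         (use s in \<open>simp add: p p_def[symmetric] algebra_simps\<close>)
    have "(W has_real_derivative (exp (-s) * p * (y - s)) * (f1 * g0 - f0 * g1)
        + ((- (x + 1) * f2) * g0 + (- x * g1) * f1 - ((- x * f1) * g1 + (- (x + 1) * g2) * f0))
           * (exp (-s) * s powr y)) (at s)"
      unfolding W_eq fg
      by (intro DERIV_mult DERIV_diff Dp D0 D1 F G s)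
    also have "(exp (-s) * p * (y - s)) * (f1 * g0 - f0 * g1)
        + ((- (x + 1) * f2) * g0 + (- x * g1) * f1 - ((- x * f1) * g1 + (- (x + 1) * g2) * f0))
           * (exp (-s) * s powr y)
       = exp (-s) * p * ((y - s) * (f1 * g0 - f0 * g1)
            - ((s * ((x + 1) * f2)) * g0 - f0 * (s * ((x + 1) * g2))))"
      unfolding p by (simp add: algebra_simps)
    also have "\<dots> = 0" unfolding oF oG by (simp add: algebra_simps)
    finally show ?thesis .
  qed
  have "\<exists>c. \<forall>s\<in>{0<..}. W s = c"
    by (rule has_field_derivative_zero_constant)
       (auto intro: has_field_derivative_at_within Wderiv)
  then obtain c where c: "\<And>s. s > 0 \<Longrightarrow> W s = c" by auto
  have "(W \<longlongrightarrow> c) (at_right 0)"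
    by (rule tendsto_eventually) (auto simp: eventually_at_right_less c intro: eventually_at_rightI[of 0 1])
  hence "c = 0" using W0 tendsto_unique[of "at_right (0::real)"] by fastforce
  hence wr: "F (x + 1) (y + 1) s * G x y s = F x y s * G (x + 1) (y + 1) s" if "s > 0" for s
    using c[OF that] that unfolding W_def by (auto simp: algebra_simps)
  \<comment> \<open>A vanishing Wronskian only gives \<open>F = d * G\<close>; the limits 0 of
    \<open>F\<close> and \<open>K > 0\<close> of \<open>G\<close> then force
    \<open>d = 0\<close>.\<close>
  have "((\<lambda>s. F x y s / G x y s) has_real_derivative 0) (at s)" if s: "s > 0" for s
  proof -
    have "((\<lambda>s. F x y s / G x y s) has_real_derivative
        ((- x * F (x + 1) (y + 1) s) * G x y s - F x y s * (- x * G (x + 1) (y + 1) s))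
          / (G x y s * G x y s)) (at s)"
      using Gpos[OF s] by (intro DERIV_divide D0 F G s) auto
    also have "(- x * F (x + 1) (y + 1) s) * G x y s - F x y s * (- x * G (x + 1) (y + 1) s) = 0"
      using wr[OF s] by (simp add: algebra_simps)
    finally show ?thesis by simp
  qed
  hence "\<exists>d. \<forall>s\<in>{0<..}. F x y s / G x y s = d"
    by (intro has_field_derivative_zero_constant)
       (auto intro: has_field_derivative_at_within)
  then obtain d where d: "\<And>s. s > 0 \<Longrightarrow> F x y s / G x y s = d" by auto
  have "((\<lambda>s. F x y s / G x y s) \<longlongrightarrow> d) (at_right 0)"
    by (rule tendsto_eventually) (auto simp: d intro: eventually_at_rightI[of 0 1])
  moreover have "((\<lambda>s. F x y s / G x y s) \<longlongrightarrow> 0 / K) (at_right 0)"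
    using K by (intro tendsto_divide lim0 limG0) auto
  ultimately have "d = 0" using tendsto_unique[of "at_right (0::real)"] by fastforce
  thus ?thesis using d[OF z] Gpos[OF z] by auto
qed

text \<open>Induction on the integer part of \<open>y\<close>, for all \<open>x > 0\<close>
  simultaneously because the relations also move \<open>x\<close>.\<close>

lemma tricomi_family_zero_extend:
  assumes F: "tricomi_family F"
    and strip: "\<And>x y z. x > 0 \<Longrightarrow> 0 < y \<Longrightarrow> y < 1 \<Longrightarrow> z > 0 \<Longrightarrow> F x y z = 0"
    and "x > 0" "y \<notin> \<int>" "z > 0"
  shows "F x y z = 0"
proof -
  define f where "f = frac y"
  have f: "0 < f" "f < 1" using assms(4) by (simp_all add: f_def frac_lt_1 frac_gt_0_iff)
  have ni: "f + of_int n \<notin> \<int>" for n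
    using nonint_strip[OF f] Ints_diff[of "f + of_int n" "of_int n"] by auto
  have "\<forall>x>0. F x (f + of_int n) z = 0" for n :: int
  proof (induction n rule: int_induct[where k = 0])
    case base
    thus ?case using strip f \<open>z > 0\<close> by simp
  next
    case (step1 n)
    \<comment> \<open>The second relation reaches only first arguments above 1. The first relation,
      read at \<open>n + 1\<close>, then brings the argument down to every
      \<open>x > 0\<close>.\<close>
    have up: "F (x + 1) (f + of_int (n + 1)) z = 0" if "x > 0" for x
      using tricomi_familyD(2)[OF F that ni[of n] \<open>z > 0\<close>] step1.IH that \<open>z > 0\<close>
      by (simp add: add.assoc)
    show ?case
    proof (intro allI impI)
      fix x :: real assume "x > 0"
      thus "F x (f + of_int (n + 1)) z = 0"
        using tricomi_familyD(1)[OF F \<open>x > 0\<close> ni[of "n + 1"] \<open>z > 0\<close>] up step1.IH by simp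
    qed
  next
    case (step2 n)
    show ?case
    proof (intro allI impI)
      fix x :: real assume "x > 0"
      thus "F x (f + of_int (n - 1)) z = 0"
        using tricomi_familyD(1)[OF F \<open>x > 0\<close> ni[of "n"] \<open>z > 0\<close>] step2.IH
        by (simp add: algebra_simps)
    qed
  qed
  moreover have "y = f + of_int \<lfloor>y\<rfloor>" by (simp add: f_def frac_def)
  ultimately show ?thesis using \<open>x > 0\<close> by metis
qed

section \<open>Boundary values of the defining formula at the origin for
  \<open>0 < y < 1\<close>\<close>

lemma Gamma_reflection_real: "Gamma x * Gamma (1 - x) = pi / sin (pi * x)" for x :: real
proof -
  have "complex_of_real (Gamma x * Gamma (1 - x)) = Gamma (of_real x) * Gamma (1 - of_real x)"
    by (simp flip: Gamma_complex_of_real)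
  also have "\<dots> = of_real pi / sin (of_real pi * of_real x)"
    by (rule Gamma_reflection_complex)
  also have "\<dots> = complex_of_real (pi / sin (pi * x))"
    by (simp flip: sin_of_real)
  finally show ?thesis using of_real_eq_iff by blast
qed

lemma pi_sin_rGamma_strip:
  assumes "0 < y" "y < (1::real)"
  shows "pi / sin (pi * y) * rGamma y = Gamma (1 - y)" "pi / sin (pi * y) * rGamma (1 - y) = Gamma y"
  using assms unfolding Gamma_reflection_real[symmetric] rGamma_inverse_Gamma
  by (auto simp: Gamma_eq_zero_iff field_simps dest: nonpos_Ints_nonpos)

text \<open>The second summand dies with \<open>z powr (1 - y)\<close> because \<open>y < 1\<close>;
  the reflection formula simplifies the constant left by the first.\<close>

lemma tricomi_formula_strip_tendsto:
  assumes "x > 0" "0 < y" "y < 1"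
  shows "(tricomi_formula x y \<longlongrightarrow> Gamma (1 - y) * rGamma (1 + x - y)) (at_right 0)"
proof -
  have yn: "y \<notin> \<int>" using assms nonint_strip by blast
  have "((\<lambda>z. tricomi_sol1 x y z - tricomi_sol2 x y z) \<longlongrightarrow>
      pi / sin (pi * y) * (rGamma (1 + x - y) * rGamma y)
       - pi / sin (pi * y) * (0 * (1 * rGamma x * rGamma (2 - y)))) (at_right 0)"
    unfolding tricomi_sol2_def
    using assms yn nonint_shift(3)[OF yn]
    by (intro tendsto_diff tricomi_sol1_tendsto_0 tendsto_mult tendsto_const tendsto_powr_0_at_right
         kummer_M_tendsto_0) auto
  thus ?thesis unfolding tricomi_formula_eq[abs_def] pi_sin_rGamma_strip(1)[OF assms(2,3), symmetric]
    by (simp add: mult_ac)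
qed

text \<open>Up to the factor \<open>- x\<close> this is \<open>z powr y\<close> times the
  derivative. Here the first summand dies because \<open>y > 0\<close>, while
  \<open>z powr y\<close> exactly cancels the \<open>z powr (- y)\<close> of the second.\<close>

lemma tricomi_formula_strip_tendsto_deriv:
  assumes "x > 0" "0 < y" "y < 1"
  shows "((\<lambda>z. z powr y * tricomi_formula (x + 1) (y + 1) z) \<longlongrightarrow> Gamma y * rGamma (x + 1)) (at_right 0)"
proof -
  have yn: "y \<notin> \<int>" using assms nonint_strip by blast
  have yn1: "y + 1 \<notin> \<int>" and yn2: "1 - y \<notin> \<int>" using nonint_shift[OF yn] by auto
  let ?c = "pi / sin (pi * y)"
  have "((\<lambda>z. z powr y * tricomi_sol1 (x + 1) (y + 1) z
         + ?c * (kummer_M (1 + x - y) (1 - y) z * rGamma (x + 1) * rGamma (1 - y))) \<longlongrightarrow>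
      0 * (pi / sin (pi * (y + 1)) * (rGamma (1 + (x + 1) - (y + 1)) * rGamma (y + 1)))
       + ?c * (1 * rGamma (x + 1) * rGamma (1 - y))) (at_right 0)"
    using assms yn1 yn2
    by (intro tendsto_add tricomi_sol1_tendsto_0 tendsto_mult tendsto_const tendsto_powr_0_at_right
         kummer_M_tendsto_0) auto
  moreover have "z powr y * tricomi_sol1 (x + 1) (y + 1) z
         + ?c * (kummer_M (1 + x - y) (1 - y) z * rGamma (x + 1) * rGamma (1 - y))
       = z powr y * tricomi_formula (x + 1) (y + 1) z" if "z > 0" for z
  proof -
    define k where "k = ?c * (kummer_M (1 + x - y) (1 - y) z * rGamma (x + 1) * rGamma (1 - y))"
    have e: "1 + (x + 1) - (y + 1) = 1 + x - y" "2 - (y + 1) = 1 - y" "1 - (y + 1) = - y" by simp_all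
    \<comment> \<open>The minus sign comes from the sine at \<open>y + 1\<close>; together with the
      minus sign of \<open>tricomi_formula_eq\<close> it makes the contribution positive.\<close>
    have "tricomi_sol2 (x + 1) (y + 1) z = - (z powr (- y) * k)"
      by (simp only: tricomi_sol2_def sin_pi_shift e k_def) simp
    moreover have "z powr y * (z powr (- y) * k) = k" using that by (simp add: powr_minus)
    ultimately show ?thesis unfolding tricomi_formula_eq k_def[symmetric]
      by (simp add: algebra_simps)
  qed
  ultimately have "((\<lambda>z. z powr y * tricomi_formula (x + 1) (y + 1) z) \<longlongrightarrow>
      0 * (pi / sin (pi * (y + 1)) * (rGamma (1 + (x + 1) - (y + 1)) * rGamma (y + 1)))
       + ?c * (1 * rGamma (x + 1) * rGamma (1 - y))) (at_right 0)"
    by (elim Lim_transform_eventually) (auto intro: eventually_at_rightI[of 0 1])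
  thus ?thesis unfolding pi_sin_rGamma_strip(2)[OF assms(2,3), symmetric]
    by (simp add: mult_ac)
qed

lemma tricomi_formula_unique:
  assumes F: "tricomi_family F"
    and lim0: "\<And>x y. x > 0 \<Longrightarrow> 0 < y \<Longrightarrow> y < 1 \<Longrightarrow>
           (F x y \<longlongrightarrow> Gamma (1 - y) * rGamma (1 + x - y)) (at_right 0)"
    and lim1: "\<And>x y. x > 0 \<Longrightarrow> 0 < y \<Longrightarrow> y < 1 \<Longrightarrow>
           ((\<lambda>z. z powr y * F (x + 1) (y + 1) z) \<longlongrightarrow> Gamma y * rGamma (x + 1)) (at_right 0)"
    and "x > 0" "y \<notin> \<int>" "z > 0"
  shows "F x y z = tricomi_formula x y z"
proof -
  define H where "H = (\<lambda>x y z. F x y z - tricomi_formula x y z)"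
  have H: "tricomi_family H"
    unfolding H_def by (intro tricomi_family_diff F tricomi_family_tricomi_formula)
  have "H x y z = 0"
  proof (rule tricomi_family_zero_extend[OF H])
    fix x y z :: real assume *: "x > 0" "0 < y" "y < 1" "z > 0"
    show "H x y z = 0"
    proof (rule tricomi_family_unique_strip[OF H *(1-3) _ _ *(4)])
      show "(H x y \<longlongrightarrow> 0) (at_right 0)"
        using tendsto_diff[OF lim0[OF *(1-3)] tricomi_formula_strip_tendsto[OF *(1-3)]]
        by (simp add: H_def)
      show "((\<lambda>z. z powr y * H (x + 1) (y + 1) z) \<longlongrightarrow> 0) (at_right 0)"
        using tendsto_diff[OF lim1[OF *(1-3)] tricomi_formula_strip_tendsto_deriv[OF *(1-3)]]
        by (simp add: H_def right_diff_distrib)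
    qed
  qed (use assms in auto)
  thus ?thesis by (simp add: H_def)
qed

section \<open>The Laplace integral\<close>

text \<open>Sequences suffice in a first countable space. The set \<open>S\<close> lets a caller
  restrict the parameter to a region on which one dominating function works.\<close>

lemma integral_dominated_convergence_within:
  fixes f :: "'a::first_countable_topology \<Rightarrow> 'b \<Rightarrow> 'c::{banach, second_countable_topology}"
  assumes meas: "\<And>y. y \<in> S \<Longrightarrow> y \<noteq> a \<Longrightarrow> f y \<in> borel_measurable M"
    and g: "g \<in> borel_measurable M" and w: "integrable M w"
    and lim: "\<And>x. x \<in> space M \<Longrightarrow> ((\<lambda>y. f y x) \<longlongrightarrow> g x) (at a within S)"
    and bound: "\<And>x y. x \<in> space M \<Longrightarrow> y \<in> S \<Longrightarrow> y \<noteq> a \<Longrightarrow> norm (f y x) \<le> w x"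
  shows "((\<lambda>y. integral\<^sup>L M (f y)) \<longlongrightarrow> integral\<^sup>L M g) (at a within S)"
  unfolding tendsto_at_iff_sequentially comp_def
proof (intro allI impI)
  fix X assume X: "\<forall>i. X i \<in> S - {a}" "X \<longlonglongrightarrow> a"
  show "(\<lambda>i. integral\<^sup>L M (f (X i))) \<longlonglongrightarrow> integral\<^sup>L M g"
  proof (rule integral_dominated_convergence[OF g _ w])
    show "AE x in M. (\<lambda>i. f (X i) x) \<longlonglongrightarrow> g x"
      using lim X unfolding tendsto_at_iff_sequentially comp_def by (intro AE_I2) blast
  qed (use meas bound X in auto)
qed

lemma one_plus_powr_le_exp:
  assumes "c > (0::real)"
  obtains K where "K > 0" "\<And>t. t \<ge> 0 \<Longrightarrow> (1 + t) powr \<beta> \<le> K * exp (c * t)"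
proof
  \<comment> \<open>Chosen so that \<open>ln u \<le> u\<close> at \<open>u = d * (1 + t)\<close>,
    multiplied by \<open>\<bar>\<beta>\<bar> + 1\<close>, has slope exactly \<open>c\<close> in
    \<open>t\<close>; the added 1 covers \<open>\<beta> = 0\<close>.\<close>
  define d where "d = c / (\<bar>\<beta>\<bar> + 1)"
  have d: "d > 0" using assms by (simp add: d_def)
  have dc: "(\<bar>\<beta>\<bar> + 1) * d = c" by (simp add: d_def)
  show "exp ((\<bar>\<beta>\<bar> + 1) * (d - ln d)) > 0" by simp
  fix t :: real assume t: "t \<ge> 0"
  have "ln (d * (1 + t)) \<le> d * (1 + t)"
    using d t by (intro ln_bound) auto
  hence l: "ln (1 + t) \<le> d * (1 + t) - ln d"
    using d t by (simp add: ln_mult)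
  have "\<beta> * ln (1 + t) \<le> (\<bar>\<beta>\<bar> + 1) * ln (1 + t)"
    using t by (intro mult_right_mono) auto
  also have "\<dots> \<le> (\<bar>\<beta>\<bar> + 1) * (d * (1 + t) - ln d)"
    using l by (intro mult_left_mono) auto
  also have "\<dots> = (\<bar>\<beta>\<bar> + 1) * (d - ln d) + ((\<bar>\<beta>\<bar> + 1) * d) * t"
    by (simp add: algebra_simps)
  also have "\<dots> = (\<bar>\<beta>\<bar> + 1) * (d - ln d) + c * t"
    unfolding dc ..
  finally have "exp (\<beta> * ln (1 + t)) \<le> exp ((\<bar>\<beta>\<bar> + 1) * (d - ln d) + c * t)"
    by simp
  thus "(1 + t) powr \<beta> \<le> exp ((\<bar>\<beta>\<bar> + 1) * (d - ln d)) * exp (c * t)"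
    using t by (simp add: powr_def exp_add)
qed

lemma Gamma_kernel:
  assumes "\<alpha> > (0::real)"
  shows "integrable lborel (\<lambda>t. indicator {0<..} t * (t powr (\<alpha> - 1) * exp (- t)))"
    and "(LINT t|lborel. indicator {0<..} t * (t powr (\<alpha> - 1) * exp (- t))) = Gamma \<alpha>"
proof -
  let ?f = "\<lambda>t. indicator {0<..} t * (t powr (\<alpha> - 1) * exp (- t)) :: real"
  have "(\<integral>\<^sup>+ t. ennreal (?f t) \<partial>lborel) = (\<integral>\<^sup>+ t. ennreal (indicator {0..} t * t powr (\<alpha> - 1) / exp t) \<partial>lborel)"
    by (intro nn_integral_cong) (auto simp: exp_minus field_simps split: split_indicator)
  hence *: "(\<integral>\<^sup>+ t. ennreal (?f t) \<partial>lborel) = ennreal (Gamma \<alpha>)"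
    using Gamma_conv_nn_integral_real[OF assms] by simp
  show "integrable lborel ?f"
    by (intro integrableI_nonneg AE_I2) (auto simp: *)
  show "integral\<^sup>L lborel ?f = Gamma \<alpha>"
    by (subst integral_eq_nn_integral) (use Gamma_real_pos[OF assms] in \<open>auto simp: *\<close>)
qed

lemma Gamma_kernel_scaled_integrable:
  assumes "\<alpha> > (0::real)" "c > 0"
  shows "integrable lborel (\<lambda>t. indicator {0<..} t * (t powr (\<alpha> - 1) * exp (- (c * t))))"
proof -
  have "integrable lborel (\<lambda>t. inverse (c powr (\<alpha> - 1)) * (indicator {0<..} (0 + c * t)
      * ((0 + c * t) powr (\<alpha> - 1) * exp (- (0 + c * t)))))"
    using assms by (intro integrable_mult_right lborel_integrable_real_affine Gamma_kernel(1)) auto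
  also have "(\<lambda>t. inverse (c powr (\<alpha> - 1)) * (indicator {0<..} (0 + c * t)
      * ((0 + c * t) powr (\<alpha> - 1) * exp (- (0 + c * t)))))
     = (\<lambda>t. indicator {0<..} t * (t powr (\<alpha> - 1) * exp (- (c * t))))"
    using assms by (auto simp: fun_eq_iff powr_mult zero_less_mult_iff split: split_indicator)
  finally show ?thesis .
qed

definition laplace_kernel :: "real \<Rightarrow> real \<Rightarrow> real \<Rightarrow> real \<Rightarrow> real" where
  "laplace_kernel \<alpha> \<beta> z t = indicator {0<..} t * (t powr (\<alpha> - 1) * (1 + t) powr \<beta> * exp (- (z * t)))"

definition laplace_int :: "real \<Rightarrow> real \<Rightarrow> real \<Rightarrow> real" where
  "laplace_int \<alpha> \<beta> z = (LINT t|lborel. laplace_kernel \<alpha> \<beta> z t)"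

lemma laplace_kernel_nonneg [simp]: "laplace_kernel \<alpha> \<beta> z t \<ge> 0"
  by (simp add: laplace_kernel_def)

lemma laplace_kernel_measurable [measurable]: "laplace_kernel \<alpha> \<beta> z \<in> borel_measurable borel"
  unfolding laplace_kernel_def[abs_def] by measurable

lemma laplace_kernel_integrable:
  assumes "\<alpha> > 0" "z > 0"
  shows "integrable lborel (laplace_kernel \<alpha> \<beta> z)"
proof -
  obtain K where K: "K > 0" "\<And>t. t \<ge> 0 \<Longrightarrow> (1 + t) powr \<beta> \<le> K * exp (z / 2 * t)"
    using one_plus_powr_le_exp[of "z / 2" \<beta>] assms by auto
  show ?thesis
  proof (rule Bochner_Integration.integrable_bound)
    show "integrable lborel (\<lambda>t. K * (indicator {0<..} t * (t powr (\<alpha> - 1) * exp (- (z / 2 * t)))))"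
      using assms by (intro integrable_mult_right Gamma_kernel_scaled_integrable) auto
    have "laplace_kernel \<alpha> \<beta> z t \<le> K * (indicator {0<..} t * (t powr (\<alpha> - 1) * exp (- (z / 2 * t))))" for t
    proof (cases "t > 0")
      case True
      have "t powr (\<alpha> - 1) * (1 + t) powr \<beta> * exp (- (z * t))
          \<le> t powr (\<alpha> - 1) * (K * exp (z / 2 * t)) * exp (- (z * t))"
        using True K by (intro mult_mono) auto
      also have "\<dots> = K * (t powr (\<alpha> - 1) * exp (- (z / 2 * t)))"
        by (simp add: algebra_simps flip: exp_add)
      finally show ?thesis using True by (simp add: laplace_kernel_def)
    qed (simp add: laplace_kernel_def)
    thus "AE t in lborel. norm (laplace_kernel \<alpha> \<beta> z t)
        \<le> norm (K * (indicator {0<..} t * (t powr (\<alpha> - 1) * exp (- (z / 2 * t)))))"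
      using K(1) by (intro AE_I2) (simp add: abs_mult)
  qed simp
qed

lemma laplace_kernel_Suc_left: "laplace_kernel (\<alpha> + 1) \<beta> z t = t * laplace_kernel \<alpha> \<beta> z t"
  by (auto simp: laplace_kernel_def powr_mult_base split: split_indicator)

text \<open>Splits off one factor \<open>1 + t\<close> of the integrand.\<close>

lemma laplace_int_add:
  assumes "\<alpha> > 0" "z > 0"
  shows "laplace_int \<alpha> (\<beta> + 1) z = laplace_int \<alpha> \<beta> z + laplace_int (\<alpha> + 1) \<beta> z"
proof -
  have "laplace_int \<alpha> (\<beta> + 1) z = (LINT t|lborel. laplace_kernel \<alpha> \<beta> z t + laplace_kernel (\<alpha> + 1) \<beta> z t)"
    unfolding laplace_int_def laplace_kernel_Suc_left
    by (intro Bochner_Integration.integral_cong refl)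
       (auto simp: laplace_kernel_def powr_add algebra_simps split: split_indicator)
  also have "\<dots> = laplace_int \<alpha> \<beta> z + laplace_int (\<alpha> + 1) \<beta> z"
    unfolding laplace_int_def using assms
    by (intro Bochner_Integration.integral_add laplace_kernel_integrable) auto
  finally show ?thesis .
qed

text \<open>The derivative of
  \<open>t powr \<alpha> * (1 + t) powr \<beta> * exp (- (z * t))\<close> integrates to zero, since
  the boundary terms vanish at 0 by \<open>\<alpha> > 0\<close> and at infinity by
  \<open>z > 0\<close>.\<close>

lemma laplace_int_by_parts:
  assumes a: "\<alpha> > 0" and z: "z > 0"
  shows "z * laplace_int (\<alpha> + 1) \<beta> z = \<alpha> * laplace_int \<alpha> \<beta> z + \<beta> * laplace_int (\<alpha> + 1) (\<beta> - 1) z"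
proof -
  define F where "F t = t powr \<alpha> * (1 + t) powr \<beta> * exp (- (z * t))" for t :: real
  define f where "f t = \<alpha> * laplace_kernel \<alpha> \<beta> z t + \<beta> * laplace_kernel (\<alpha> + 1) (\<beta> - 1) z t
      - z * laplace_kernel (\<alpha> + 1) \<beta> z t" for t
  define f' where "f' t = \<alpha> * (t powr (\<alpha> - 1) * (1 + t) powr \<beta> * exp (- (z * t)))
      + \<beta> * (t powr \<alpha> * (1 + t) powr (\<beta> - 1) * exp (- (z * t)))
      - z * (t powr \<alpha> * (1 + t) powr \<beta> * exp (- (z * t)))" for t :: real
  have ff: "f t = indicator {0<..} t * f' t" for t
    by (simp add: f_def f'_def laplace_kernel_def algebra_simps)
  have fint: "integrable lborel f"
    unfolding f_def using a z
    by (intro Bochner_Integration.integrable_diff Bochner_Integration.integrable_add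
          integrable_mult_right laplace_kernel_integrable) auto
  have ei: "einterval 0 \<infinity> = {0<..}"
    by (auto simp: einterval_def zero_ereal_def)
  have "(LBINT t=0..\<infinity>. f' t) = 0 - 0"
  proof (rule interval_integral_FTC_integrable)
    fix x :: real assume "0 < ereal x"
    hence x: "x > 0" by simp
    have "(F has_real_derivative f' x) (at x)"
      unfolding F_def[abs_def] f'_def
      by (rule derivative_eq_intros refl | (use x in \<open>simp; fail\<close>))+
         (use x in \<open>simp add: algebra_simps\<close>)
    thus "(F has_vector_derivative f' x) (at x)"
      by (simp add: has_real_derivative_iff_has_vector_derivative)
    show "isCont f' x"
      unfolding f'_def[abs_def] using x by (intro continuous_intros) auto
  next
    show "set_integrable lborel (einterval 0 \<infinity>) f'"
      unfolding set_integrable_def ei using fint ff by (simp add: ff[abs_def] cong: if_cong)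
  next
    have "(F \<longlongrightarrow> 0 * (1 + 0) powr \<beta> * exp (- (z * 0))) (at_right 0)"
      unfolding F_def[abs_def] using a
      by (intro tendsto_intros tendsto_powr_0_at_right) auto
    thus "((F \<circ> real_of_ereal) \<longlongrightarrow> 0) (at_right 0)"
      by (simp add: zero_ereal_def ereal_tendsto_simps)
    have "(F \<longlongrightarrow> 0) at_top"
      unfolding F_def[abs_def] using z by real_asymp
    thus "((F \<circ> real_of_ereal) \<longlongrightarrow> 0) (at_left \<infinity>)"
      by (simp add: ereal_tendsto_simps)
  qed simp
  hence "integral\<^sup>L lborel f = 0"
    by (simp add: interval_lebesgue_integral_def set_lebesgue_integral_def ei ff[abs_def])
  moreover have "integral\<^sup>L lborel f = \<alpha> * laplace_int \<alpha> \<beta> z + \<beta> * laplace_int (\<alpha> + 1) (\<beta> - 1) z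
      - z * laplace_int (\<alpha> + 1) \<beta> z"
    unfolding f_def laplace_int_def using a z by (simp add: laplace_kernel_integrable)
  ultimately show ?thesis by simp
qed

lemma abs_exp_minus_1_le: "\<bar>exp u - 1\<bar> \<le> \<bar>u\<bar> * exp \<bar>u\<bar>" for u :: real
proof (cases "u \<ge> 0")
  case True
  have "exp u * (1 - u) \<le> exp u * exp (- u)"
    using exp_ge_add_one_self[of "-u"] by (intro mult_left_mono) auto
  thus ?thesis using True by (simp add: exp_minus algebra_simps)
next
  case False
  have "1 - exp u \<le> - u * 1" using exp_ge_add_one_self[of u] by linarith
  also have "\<dots> \<le> - u * exp (- u)" using False by (intro mult_left_mono) auto
  finally show ?thesis using False by simp
qed

lemma laplace_int_has_deriv:
  assumes a: "\<alpha> > 0" and z: "z > 0"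
  shows "(laplace_int \<alpha> \<beta> has_real_derivative - laplace_int (\<alpha> + 1) \<beta> z) (at z)"
proof -
  let ?k = "laplace_kernel \<alpha> \<beta>"
  \<comment> \<open>Half of the exponential decay is given up: for
    \<open>\<bar>h\<bar> < z / 2\<close> the bound \<open>\<bar>exp u - 1\<bar> \<le> \<bar>u\<bar>
    * exp \<bar>u\<bar>\<close> dominates the difference quotients by the kernel at
    \<open>z / 2\<close>, with one more power of \<open>t\<close>.\<close>
  let ?S = "{- (z / 2)<..<z / 2}"
  have ks: "?k (z + h) t = ?k z t * exp (- (h * t))" for h t
    by (simp add: laplace_kernel_def algebra_simps exp_add exp_diff exp_minus divide_inverse)
  have "((\<lambda>h. LINT t|lborel. (?k (z + h) t - ?k z t) / h) \<longlongrightarrow> (LINT t|lborel. - laplace_kernel (\<alpha> + 1) \<beta> z t)) (at 0 within ?S)"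
  proof (rule integral_dominated_convergence_within)
    show "integrable lborel (laplace_kernel (\<alpha> + 1) \<beta> (z / 2))"
      using a z by (intro laplace_kernel_integrable) auto
    fix t :: real
    have "((\<lambda>h. exp (- (h * t))) has_real_derivative - t) (at 0)"
      by (rule derivative_eq_intros refl | simp)+
    hence "((\<lambda>h. (exp (- (h * t)) - 1) / h) \<longlongrightarrow> - t) (at 0)"
      by (simp add: has_field_derivative_iff)
    hence "((\<lambda>h. ?k z t * ((exp (- (h * t)) - 1) / h)) \<longlongrightarrow> ?k z t * (- t)) (at 0)"
      by (rule tendsto_mult_left)
    hence "((\<lambda>h. (?k (z + h) t - ?k z t) / h) \<longlongrightarrow> - laplace_kernel (\<alpha> + 1) \<beta> z t) (at 0)"
      unfolding ks laplace_kernel_Suc_left by (simp add: algebra_simps)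
    thus "((\<lambda>h. (?k (z + h) t - ?k z t) / h) \<longlongrightarrow> - laplace_kernel (\<alpha> + 1) \<beta> z t) (at 0 within ?S)"
      by (rule tendsto_within_subset) auto
    fix h :: real assume h: "h \<in> ?S" "h \<noteq> 0"
    show "norm ((?k (z + h) t - ?k z t) / h) \<le> laplace_kernel (\<alpha> + 1) \<beta> (z / 2) t"
    proof (cases "t > 0")
      case True
      have "\<bar>exp (- (h * t)) - 1\<bar> \<le> \<bar>h * t\<bar> * exp \<bar>h * t\<bar>"
        using abs_exp_minus_1_le[of "- (h * t)"] by simp
      also have "\<dots> \<le> (\<bar>h\<bar> * t) * exp (z / 2 * t)"
        using True h by (intro mult_mono) (auto simp: abs_mult)
      finally have "\<bar>exp (- (h * t)) - 1\<bar> / \<bar>h\<bar> \<le> t * exp (z / 2 * t)"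
        using h by (simp add: field_simps)
      hence "?k z t * (\<bar>exp (- (h * t)) - 1\<bar> / \<bar>h\<bar>) \<le> ?k z t * (t * exp (z / 2 * t))"
        by (intro mult_left_mono) auto
      also have "\<dots> = laplace_kernel (\<alpha> + 1) \<beta> (z / 2) t"
      proof -
        have "exp (- (z / 2 * t)) = exp (- (z * t)) * exp (z / 2 * t)"
          by (simp flip: exp_add)
        thus ?thesis unfolding laplace_kernel_Suc_left unfolding laplace_kernel_def
          by (simp only: mult_ac)
      qed
      moreover have "(?k (z + h) t - ?k z t) / h = ?k z t * ((exp (- (h * t)) - 1) / h)"
        unfolding ks by (simp add: algebra_simps)
      ultimately show ?thesis
        by (simp only: real_norm_def abs_mult abs_divide abs_of_nonneg[OF laplace_kernel_nonneg])
    qed (simp add: laplace_kernel_def)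
  qed simp_all
  also have "(LINT t|lborel. - laplace_kernel (\<alpha> + 1) \<beta> z t) = - laplace_int (\<alpha> + 1) \<beta> z"
    by (simp add: laplace_int_def)
  also have "at 0 within ?S = at (0::real)" using z by (intro at_within_open) auto
  finally have L: "((\<lambda>h. LINT t|lborel. (?k (z + h) t - ?k z t) / h) \<longlongrightarrow> - laplace_int (\<alpha> + 1) \<beta> z) (at 0)" .
  have "eventually (\<lambda>h. h \<in> ?S) (at 0)"
    using z by (intro eventually_at_in_open') auto
  hence "eventually (\<lambda>h. (LINT t|lborel. (?k (z + h) t - ?k z t) / h)
      = (laplace_int \<alpha> \<beta> (z + h) - laplace_int \<alpha> \<beta> z) / h) (at 0)"
  proof eventually_elim
    case (elim h)
    hence "z + h > 0" using z by auto
    thus ?case using a z by (simp add: laplace_int_def laplace_kernel_integrable)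
  qed
  with L show ?thesis
    unfolding DERIV_def by (rule Lim_transform_eventually)
qed

definition tricomi_int :: "real \<Rightarrow> real \<Rightarrow> real \<Rightarrow> real" where
  "tricomi_int x y z = rGamma x * laplace_int x (y - x - 1) z"

text \<open>The three relations are, in order, splitting off a factor \<open>1 + t\<close>,
  integration by parts, and differentiation under the integral sign;
  \<open>rGamma x = x * rGamma (x + 1)\<close> accounts for the factors \<open>x\<close>.\<close>

lemma tricomi_family_int: "tricomi_family tricomi_int"
  unfolding tricomi_family_def
proof (intro allI impI conjI)
  fix x y z :: real assume x: "x > 0" and z: "z > 0"
  have g: "rGamma x = x * rGamma (x + 1)" by (simp add: rGamma_plus1)
  have "laplace_int x (y - x - 1) z = laplace_int x (y - x - 2) z + laplace_int (x + 1) (y - x - 2) z"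
    using laplace_int_add[OF x z, of "y - x - 2"] by simp
  thus "tricomi_int x (y - 1) z = tricomi_int x y z - x * tricomi_int (x + 1) y z"
    unfolding tricomi_int_def g by (simp add: algebra_simps)
  have "z * laplace_int (x + 1) (y - x - 1) z =
      x * laplace_int x (y - x - 1) z + (y - x - 1) * laplace_int (x + 1) (y - x - 2) z"
    using laplace_int_by_parts[OF x z, of "y - x - 1"] by simp
  hence "rGamma (x + 1) * (z * laplace_int (x + 1) (y - x - 1) z) =
      rGamma (x + 1) * (x * laplace_int x (y - x - 1) z + (y - x - 1) * laplace_int (x + 1) (y - x - 2) z)"
    by (simp only:)
  thus "z * tricomi_int (x + 1) (y + 1) z = (y - x - 1) * tricomi_int (x + 1) y z + tricomi_int x y z"
    unfolding tricomi_int_def g by (simp add: algebra_simps)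
  have "(tricomi_int x y has_real_derivative rGamma x * (- laplace_int (x + 1) (y - x - 1) z)) (at z)"
    unfolding tricomi_int_def[abs_def] by (intro DERIV_cmult laplace_int_has_deriv x z)
  thus "(tricomi_int x y has_real_derivative - x * tricomi_int (x + 1) (y + 1) z) (at z)"
    unfolding tricomi_int_def g by (simp add: algebra_simps)
qed

section \<open>The integral representation of the Tricomi function\<close>

text \<open>The theorem for absolutely integrable functions gives equality when the integrals are
  finite, and its equivalence of integrability makes both sides infinite otherwise. The infinite
  case does occur for the mixture integral at \<open>t = 0\<close>.\<close>

lemma nn_integral_change_of_variables_1:
  fixes f g g' :: "real \<Rightarrow> real"
  assumes [measurable]: "S \<in> sets borel" "g ` S \<in> sets borel" "f \<in> borel_measurable borel"
    and meas [measurable]: "(\<lambda>x. indicator S x * (\<bar>g' x\<bar> * f (g x))) \<in> borel_measurable borel"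
    and der: "\<And>x. x \<in> S \<Longrightarrow> (g has_field_derivative g' x) (at x within S)"
    and inj: "inj_on g S"
    and nonneg: "\<And>y. y \<in> g ` S \<Longrightarrow> f y \<ge> 0"
  shows "(\<integral>\<^sup>+ y. ennreal (indicator (g ` S) y * f y) \<partial>lborel)
           = (\<integral>\<^sup>+ x. ennreal (indicator S x * (\<bar>g' x\<bar> * f (g x))) \<partial>lborel)"
proof -
  have abs_iff: "h absolutely_integrable_on T \<longleftrightarrow> integrable lborel (\<lambda>x. indicator T x * h x)"
    if "(\<lambda>x. indicator T x * h x) \<in> borel_measurable borel" for h :: "real \<Rightarrow> real" and T
    using that by (simp add: set_integrable_def integrable_completion)
  have int_eq: "integral T h = (LINT x|lborel. indicator T x * h x)"
    if "integrable lborel (\<lambda>x. indicator T x * h x)" for h :: "real \<Rightarrow> real" and T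
    using set_borel_integral_eq_integral(2)[of T h] that
    by (simp add: set_integrable_def set_lebesgue_integral_def)
  let ?F = "\<lambda>y. indicator (g ` S) y * f y" and ?G = "\<lambda>x. indicator S x * (\<bar>g' x\<bar> * f (g x))"
  have F0: "?F y \<ge> 0" for y using nonneg by (auto split: split_indicator)
  have G0: "?G x \<ge> 0" for x using nonneg by (auto split: split_indicator)
  have [measurable]: "?F \<in> borel_measurable borel" by measurable
  note cov = has_absolute_integral_change_of_variables_1'[of S g g' f, OF _ der inj]
  have S: "S \<in> sets lebesgue" by simp
  note iff = cov[OF S, unfolded abs_iff[of S, OF meas]
      abs_iff[of "g ` S" f, OF \<open>?F \<in> borel_measurable borel\<close>]]
  show ?thesis
  proof (cases "integrable lborel ?F")
    case True
    with iff have G: "integrable lborel ?G" and *: "integral S (\<lambda>x. \<bar>g' x\<bar> * f (g x)) = integral (g ` S) f"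
      by blast+
    have "(LINT x|lborel. ?F x) = (LINT x|lborel. ?G x)"
      using * int_eq[OF True] int_eq[OF G] by simp
    thus ?thesis
      using True G F0 G0 by (simp add: nn_integral_eq_integral)
  next
    case False
    with iff have G: "\<not> integrable lborel ?G" by blast
    have "(\<integral>\<^sup>+ y. ennreal (?F y) \<partial>lborel) = \<infinity>"
      using False F0 by (auto simp: integrable_iff_bounded less_top[symmetric])
    moreover have "(\<integral>\<^sup>+ y. ennreal (?G y) \<partial>lborel) = \<infinity>"
      using G G0 by (auto simp: integrable_iff_bounded less_top[symmetric])
    ultimately show ?thesis by simp
  qed
qed

lemma image_ratio_Ioi:
  assumes "(\<xi>::real) > 0"
  shows "(\<lambda>u. u / (u + \<xi>)) ` {0<..} = {0<..<1}"
proof (intro equalityI subsetI)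
  fix k :: real assume k: "k \<in> {0<..<1}"
  \<comment> \<open>The witness is the solution \<open>u\<close> of
    \<open>k = u / (u + \<xi>)\<close>.\<close>
  have "k = (\<xi> * k / (1 - k)) / (\<xi> * k / (1 - k) + \<xi>)"
    using k assms by (simp add: divide_simps) (simp add: algebra_simps)
  moreover have "\<xi> * k / (1 - k) > 0" using k assms by simp
  ultimately show "k \<in> (\<lambda>u. u / (u + \<xi>)) ` {0<..}" by (intro image_eqI) auto
qed (use assms in \<open>auto simp: divide_simps\<close>)

text \<open>The weight \<open>\<xi> / (u + \<xi>)\<^sup>2\<close> is the Jacobian of the
  substitution. It serves twice: with \<open>\<xi> = 1\<close> for the Beta integral and with the
  parameter of G3B for the mixture.\<close>

lemma nn_integral_Ioo_ratio:
  fixes f :: "real \<Rightarrow> real"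
  assumes [measurable]: "f \<in> borel_measurable borel" and \<xi>: "\<xi> > 0"
    and nonneg: "\<And>k. 0 < k \<Longrightarrow> k < 1 \<Longrightarrow> f k \<ge> 0"
  shows "(\<integral>\<^sup>+ k. ennreal (indicator {0<..<1} k * f k) \<partial>lborel)
           = (\<integral>\<^sup>+ u. ennreal (indicator {0<..} u * (\<xi> / (u + \<xi>)\<^sup>2 * f (u / (u + \<xi>)))) \<partial>lborel)"
proof -
  have "(\<integral>\<^sup>+ k. ennreal (indicator ((\<lambda>u. u / (u + \<xi>)) ` {0<..}) k * f k) \<partial>lborel)
           = (\<integral>\<^sup>+ u. ennreal (indicator {0<..} u * (\<bar>\<xi> / (u + \<xi>)\<^sup>2\<bar> * f (u / (u + \<xi>)))) \<partial>lborel)"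
  proof (rule nn_integral_change_of_variables_1)
    show "(\<lambda>u. u / (u + \<xi>)) ` {0<..} \<in> sets borel" using image_ratio_Ioi[OF \<xi>] by simp
    show "inj_on (\<lambda>u. u / (u + \<xi>)) {0<..}"
      using \<xi> by (auto intro!: inj_onI simp: field_simps)
    show "((\<lambda>u. u / (u + \<xi>)) has_field_derivative \<xi> / (u + \<xi>)\<^sup>2) (at u within {0<..})"
      if "u \<in> {0<..}" for u
      using that \<xi> by (auto intro!: derivative_eq_intros simp: power2_eq_square)
    show "f y \<ge> 0" if "y \<in> (\<lambda>u. u / (u + \<xi>)) ` {0<..}" for y
      using that nonneg unfolding image_ratio_Ioi[OF \<xi>] by auto
  qed simp_all
  thus ?thesis using \<xi> by (simp add: image_ratio_Ioi)
qed

section \<open>Boundary values of the Laplace integral at the origin for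
  \<open>0 < y < 1\<close>\<close>

definition laplace_nn :: "real \<Rightarrow> real \<Rightarrow> real \<Rightarrow> ennreal" where
  "laplace_nn \<alpha> \<beta> z = (\<integral>\<^sup>+ t. ennreal (laplace_kernel \<alpha> \<beta> z t) \<partial>lborel)"

lemma laplace_nn_eq:
  assumes "\<alpha> > 0" "z > 0"
  shows "laplace_nn \<alpha> \<beta> z = ennreal (laplace_int \<alpha> \<beta> z)"
  unfolding laplace_nn_def laplace_int_def
  using laplace_kernel_integrable[OF assms] by (intro nn_integral_eq_integral) auto

text \<open>Euler's Beta integral on the half line, from \<open>k = u / (u + 1)\<close>. With
  \<open>p = x\<close> and \<open>r = 1 - y\<close> it evaluates the integral at
  \<open>z = 0\<close> in the strip.\<close>

lemma laplace_nn_0_Beta: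
  assumes p: "p > 0" and r: "r > 0"
  shows "laplace_nn p (- (p + r)) 0 = ennreal (Beta p r)"
proof -
  have "ennreal (Beta p r)
     = (\<integral>\<^sup>+ k. ennreal (k powr (p - 1) * (1 - k) powr (r - 1)) * indicator {0<..<1} k \<partial>lborel)"
    using nn_integral_has_integral_lebesgue'[OF _ has_integral_Beta_real[OF p r,
        unfolded has_integral_Icc_iff_Ioo]] by simp
  also have "\<dots> = (\<integral>\<^sup>+ k. ennreal (indicator {0<..<1} k * (k powr (p - 1) * (1 - k) powr (r - 1))) \<partial>lborel)"
    by (intro nn_integral_cong) (auto split: split_indicator)
  also have "\<dots> = (\<integral>\<^sup>+ u. ennreal (indicator {0<..} u * (1 / (u + 1)\<^sup>2 *
      ((u / (u + 1)) powr (p - 1) * (1 - u / (u + 1)) powr (r - 1)))) \<partial>lborel)"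
    by (rule nn_integral_Ioo_ratio) auto
  also have "\<dots> = laplace_nn p (- (p + r)) 0"
    unfolding laplace_nn_def
  proof (intro nn_integral_cong arg_cong[where f = ennreal])
    fix u :: real
    show "indicator {0<..} u * (1 / (u + 1)\<^sup>2 *
      ((u / (u + 1)) powr (p - 1) * (1 - u / (u + 1)) powr (r - 1))) = laplace_kernel p (- (p + r)) 0 u"
    proof (cases "u > 0")
      case True
      define v where "v = 1 + u"
      have v: "v > 0" "u + 1 = v" using True by (simp_all add: v_def)
      have "1 - u / v = 1 / v" using v by (simp add: field_simps v_def)
      moreover have "1 / v\<^sup>2 * ((u powr (p - 1) / v powr (p - 1)) * (1 / v powr (r - 1)))
          = u powr (p - 1) * v powr (- (p + r))"
      proof -
        have "v powr (p + r) = v powr (p - 1) * v powr (r - 1) * v\<^sup>2"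
          using v by (simp flip: powr_add powr_numeral)
        thus ?thesis using v unfolding powr_minus_divide by (simp add: mult_ac)
      qed
      ultimately show ?thesis
        using True v unfolding laplace_kernel_def v(2) v_def[symmetric]
        by (simp add: powr_divide)
    qed (simp add: laplace_kernel_def)
  qed
  finally show ?thesis ..
qed

lemma laplace_kernel_antimono:
  assumes "z \<le> w"
  shows "laplace_kernel \<alpha> \<beta> w t \<le> laplace_kernel \<alpha> \<beta> z t"
  unfolding laplace_kernel_def using assms
  by (auto split: split_indicator intro!: mult_left_mono mult_right_mono)

lemma laplace_kernel_tendsto: "((\<lambda>z. laplace_kernel \<alpha> \<beta> z t) \<longlongrightarrow> laplace_kernel \<alpha> \<beta> w t) (at w within S)"
  unfolding laplace_kernel_def by (intro tendsto_intros)

text \<open>For \<open>z > 0\<close> the kernel lies below the kernel at \<open>z = 0\<close>, which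
  is integrable because \<open>y < 1\<close> makes the Beta integral converge.\<close>

lemma tricomi_int_strip_tendsto:
  assumes "x > 0" "0 < y" "y < 1"
  shows "(tricomi_int x y \<longlongrightarrow> Gamma (1 - y) * rGamma (1 + x - y)) (at_right 0)"
proof -
  let ?\<beta> = "y - x - 1"
  have nn: "laplace_nn x ?\<beta> 0 = ennreal (Beta x (1 - y))"
    using laplace_nn_0_Beta[of x "1 - y"] assms by (simp add: algebra_simps)
  have B: "Beta x (1 - y) \<ge> 0"
    using assms by (auto simp: Beta_def intro!: divide_nonneg_nonneg mult_nonneg_nonneg Gamma_real_nonneg)
  have int: "integrable lborel (laplace_kernel x ?\<beta> 0)"
    using nn unfolding laplace_nn_def by (intro integrableI_nonneg AE_I2) auto
  have val: "laplace_int x ?\<beta> 0 = Beta x (1 - y)"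
    unfolding laplace_int_def using nn B unfolding laplace_nn_def
    by (subst integral_eq_nn_integral) auto
  have "((\<lambda>z. LINT t|lborel. laplace_kernel x ?\<beta> z t) \<longlongrightarrow> (LINT t|lborel. laplace_kernel x ?\<beta> 0 t)) (at 0 within {0<..})"
    by (rule integral_dominated_convergence_within[OF _ _ int])
       (auto intro: laplace_kernel_tendsto laplace_kernel_antimono)
  hence "(laplace_int x ?\<beta> \<longlongrightarrow> Beta x (1 - y)) (at_right 0)"
    using val by (simp add: laplace_int_def[abs_def])
  hence "(tricomi_int x y \<longlongrightarrow> rGamma x * Beta x (1 - y)) (at_right 0)"
    unfolding tricomi_int_def[abs_def] by (rule tendsto_mult_left)
  also have "rGamma x * Beta x (1 - y) = Gamma (1 - y) * rGamma (1 + x - y)"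
    using Gamma_real_pos[OF assms(1)] by (simp add: Beta_def rGamma_inverse_Gamma divide_inverse algebra_simps)
  finally show ?thesis .
qed

text \<open>The kernel at \<open>z = 0\<close> is not integrable for these parameters. Rescaling
  \<open>t = s / z\<close> absorbs \<open>z powr y\<close> and leaves
  \<open>s powr x * (z + s) powr (y - x - 1) * exp (- s)\<close>, whose limit is the integrand of
  \<open>Gamma y\<close>.\<close>

lemma tricomi_int_strip_tendsto_deriv:
  assumes x: "x > 0" and y: "0 < y" "y < 1"
  shows "((\<lambda>z. z powr y * tricomi_int (x + 1) (y + 1) z) \<longlongrightarrow> Gamma y * rGamma (x + 1)) (at_right 0)"
proof -
  let ?\<beta> = "y - x - 1"
  define k where "k z s = indicator {0<..} s * (s powr x * (z + s) powr ?\<beta> * exp (- s))" for z s :: real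
  have scale: "z powr y * laplace_int (x + 1) ?\<beta> z = (LINT s|lborel. k z s)" if z: "z > 0" for z
  proof -
    have "laplace_int (x + 1) ?\<beta> z = \<bar>1 / z\<bar> *\<^sub>R (LINT s|lborel. laplace_kernel (x + 1) ?\<beta> z (0 + (1 / z) * s))"
      unfolding laplace_int_def using z by (intro lborel_integral_real_affine) auto
    hence "z powr y * laplace_int (x + 1) ?\<beta> z
        = (LINT s|lborel. z powr y * (1 / z) * laplace_kernel (x + 1) ?\<beta> z (0 + (1 / z) * s))"
      using z by simp
    also have "\<dots> = (LINT s|lborel. k z s)"
    proof (intro Bochner_Integration.integral_cong refl)
      fix s :: real
      show "z powr y * (1 / z) * laplace_kernel (x + 1) ?\<beta> z (0 + (1 / z) * s) = k z s"
      proof (cases "s > 0")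
        case True
        have "1 + s / z = (z + s) / z" using z by (simp add: field_simps)
        hence "z powr y * (1 / z) * laplace_kernel (x + 1) ?\<beta> z (0 + (1 / z) * s)
           = (z powr y / (z * z powr x * z powr ?\<beta>)) * (s powr x * (z + s) powr ?\<beta> * exp (- s))"
          using z True by (simp add: laplace_kernel_def powr_divide)
        also have "z * z powr x * z powr ?\<beta> = z powr y"
          using z by (simp add: powr_mult_base flip: powr_add)
        finally show ?thesis using z True by (simp add: k_def)
      next
        case False
        thus ?thesis using z by (auto simp: k_def laplace_kernel_def zero_less_divide_iff)
      qed
    qed
    finally show ?thesis .
  qed
  have "((\<lambda>z. LINT s|lborel. k z s) \<longlongrightarrow>
      (LINT s|lborel. indicator {0<..} s * (s powr (y - 1) * exp (- s)))) (at 0 within {0<..})"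
  proof (rule integral_dominated_convergence_within)
    show "integrable lborel (\<lambda>s::real. indicator {0<..} s * (s powr (y - 1) * exp (- s)))"
      by (rule Gamma_kernel(1)[OF y(1)])
    show "(\<lambda>s::real. indicator {0<..} s * (s powr (y - 1) * exp (- s))) \<in> borel_measurable lborel"
      by measurable
    show "k z \<in> borel_measurable lborel" for z
      unfolding k_def by measurable
    fix s :: real
    have sp: "s powr x * s powr ?\<beta> = s powr (y - 1)" by (simp flip: powr_add)
    show "((\<lambda>z. k z s) \<longlongrightarrow> indicator {0<..} s * (s powr (y - 1) * exp (- s))) (at 0 within {0<..})"
    proof (cases "s > 0")
      case True
      have "((\<lambda>z. s powr x * (z + s) powr ?\<beta> * exp (- s)) \<longlongrightarrow> s powr x * (0 + s) powr ?\<beta> * exp (- s)) (at 0 within {0<..})"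
        using True by (intro tendsto_intros) auto
      thus ?thesis using True by (simp add: k_def sp)
    qed (simp add: k_def)
    fix z :: real assume z: "z \<in> {0<..}"
    show "norm (k z s) \<le> indicator {0<..} s * (s powr (y - 1) * exp (- s))"
    proof (cases "s > 0")
      case True
      \<comment> \<open>The exponent \<open>y - x - 1\<close> is negative, so dropping
        \<open>z\<close> enlarges the power; the limit function is itself the dominating
        function.\<close>
      have "s powr x * (z + s) powr ?\<beta> * exp (- s) \<le> s powr x * s powr ?\<beta> * exp (- s)"
        using True z x y by (intro mult_right_mono mult_left_mono powr_mono2') auto
      thus ?thesis using True by (simp add: k_def sp)
    qed (simp add: k_def)
  qed
  hence "((\<lambda>z. LINT s|lborel. k z s) \<longlongrightarrow> Gamma y) (at_right 0)"
    by (simp only: Gamma_kernel(2)[OF y(1)])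
  hence "((\<lambda>z. z powr y * laplace_int (x + 1) ?\<beta> z) \<longlongrightarrow> Gamma y) (at_right 0)"
    by (rule Lim_transform_eventually) (auto simp: scale intro!: eventually_at_rightI[of 0 1])
  from tendsto_mult_left[OF this, of "rGamma (x + 1)"] show ?thesis
    by (simp add: tricomi_int_def algebra_simps)
qed

lemma tricomi_int_eq_formula:
  assumes "x > 0" "y \<notin> \<int>" "z > 0"
  shows "tricomi_int x y z = tricomi_formula x y z"
  by (rule tricomi_formula_unique[OF tricomi_family_int tricomi_int_strip_tendsto
        tricomi_int_strip_tendsto_deriv assms])

section \<open>Integer second parameter and the limit at the origin\<close>

lemma tricomi_int_tendsto:
  assumes x: "x > 0" and z: "z > 0"
  shows "((\<lambda>t. tricomi_int x t z) \<longlongrightarrow> tricomi_int x y z) (at y)"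
proof -
  have "((\<lambda>t. LINT s|lborel. laplace_kernel x (t - x - 1) z s) \<longlongrightarrow>
      (LINT s|lborel. laplace_kernel x (y - x - 1) z s)) (at y within {..<y + 1})"
  proof (rule integral_dominated_convergence_within)
    \<comment> \<open>For \<open>t < y + 1\<close> the exponent \<open>t - x - 1\<close> is below
      \<open>y - x\<close>, and the base \<open>1 + s\<close> is at least 1; hence this dominating
      kernel and the one-sided restriction of \<open>t\<close>.\<close>
    show "integrable lborel (laplace_kernel x (y - x) z)"
      by (rule laplace_kernel_integrable[OF x z])
    fix s :: real
    show "((\<lambda>t. laplace_kernel x (t - x - 1) z s) \<longlongrightarrow> laplace_kernel x (y - x - 1) z s) (at y within {..<y + 1})"
      unfolding laplace_kernel_def
      by (cases "s > 0") (auto intro!: tendsto_intros)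
    fix t assume "t \<in> {..<y + 1}"
    thus "norm (laplace_kernel x (t - x - 1) z s) \<le> laplace_kernel x (y - x) z s"
      by (cases "s > 0")
         (auto simp: laplace_kernel_def intro!: mult_right_mono mult_left_mono powr_mono)
  qed simp_all
  also have "at y within {..<y + 1} = at y" by (intro at_within_open) auto
  finally show ?thesis
    unfolding tricomi_int_def laplace_int_def by (rule tendsto_mult_left)
qed

text \<open>Around an integer \<open>y\<close> the punctured interval of radius 1 contains no
  integer, so formula and integral agree there. Continuity of the integral in \<open>y\<close> then
  shows that the limit in the definition exists and what it is.\<close>

lemma tricomi_pos_eq_int:
  assumes "x > 0" "z > 0"
  shows "tricomi_pos x y z = tricomi_int x y z"
proof (cases "y \<in> \<int>")
  case False
  thus ?thesis using assms by (simp add: tricomi_pos_def tricomi_int_eq_formula)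
next
  case True
  have "eventually (\<lambda>t. t \<in> {y - 1<..<y + 1} - {y}) (at y)"
    by (rule eventually_at_in_open) auto
  hence "eventually (\<lambda>t. tricomi_int x t z = tricomi_formula x t z) (at y)"
  proof eventually_elim
    case (elim t)
    have "t \<notin> \<int>"
    proof
      assume "t \<in> \<int>"
      hence "t - y \<in> \<int>" using True by simp
      thus False using Ints_nonzero_abs_ge1[of "t - y"] elim by auto
    qed
    thus ?case using assms by (intro tricomi_int_eq_formula)
  qed
  hence "((\<lambda>t. tricomi_formula x t z) \<longlongrightarrow> tricomi_int x y z) (at y)"
    by (rule Lim_transform_eventually[OF tricomi_int_tendsto[OF assms]])
  thus ?thesis using True by (simp add: tricomi_pos_def tendsto_Lim)
qed

text \<open>Monotonicity in \<open>z\<close> bounds the limit superior from above and Fatou's lemma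
  bounds the limit inferior from below. Neither needs a finite limit, whereas dominated convergence
  would.\<close>

lemma laplace_nn_tendsto_0: "(laplace_nn \<alpha> \<beta> \<longlongrightarrow> laplace_nn \<alpha> \<beta> 0) (at_right 0)"
  unfolding tendsto_at_iff_sequentially comp_def
proof (intro allI impI)
  fix X :: "nat \<Rightarrow> real" assume X: "\<forall>i. X i \<in> {0<..} - {0}" "X \<longlonglongrightarrow> 0"
  have "laplace_nn \<alpha> \<beta> (X i) \<le> laplace_nn \<alpha> \<beta> 0" for i
    unfolding laplace_nn_def using X(1)
    by (intro nn_integral_mono ennreal_leI laplace_kernel_antimono) (auto intro: less_imp_le)
  hence up: "limsup (\<lambda>i. laplace_nn \<alpha> \<beta> (X i)) \<le> laplace_nn \<alpha> \<beta> 0"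
    by (intro Limsup_bounded) auto
  have lim: "(\<lambda>i. ennreal (laplace_kernel \<alpha> \<beta> (X i) t)) \<longlonglongrightarrow> ennreal (laplace_kernel \<alpha> \<beta> 0 t)" for t
  proof -
    have "(\<lambda>i. laplace_kernel \<alpha> \<beta> (X i) t) \<longlonglongrightarrow> laplace_kernel \<alpha> \<beta> 0 t"
      using laplace_kernel_tendsto[of \<alpha> \<beta> t 0 "{0<..}"] X
      unfolding tendsto_at_iff_sequentially comp_def by blast
    thus ?thesis by (rule tendsto_ennrealI)
  qed
  have "laplace_nn \<alpha> \<beta> 0 = (\<integral>\<^sup>+ t. liminf (\<lambda>i. ennreal (laplace_kernel \<alpha> \<beta> (X i) t)) \<partial>lborel)"
    unfolding laplace_nn_def using lim_imp_Liminf[OF _ lim] by simp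
  also have "\<dots> \<le> liminf (\<lambda>i. laplace_nn \<alpha> \<beta> (X i))"
    unfolding laplace_nn_def by (rule nn_integral_liminf) simp
  finally have lo: "laplace_nn \<alpha> \<beta> 0 \<le> liminf (\<lambda>i. laplace_nn \<alpha> \<beta> (X i))" .
  have "liminf (\<lambda>i. laplace_nn \<alpha> \<beta> (X i)) \<le> limsup (\<lambda>i. laplace_nn \<alpha> \<beta> (X i))"
    by (rule Liminf_le_Limsup) simp
  with up lo show "(\<lambda>i. laplace_nn \<alpha> \<beta> (X i)) \<longlonglongrightarrow> laplace_nn \<alpha> \<beta> 0"
    by (intro Liminf_eq_Limsup) auto
qed

text \<open>DLMF 13.4.4, including its limiting case \<open>z = 0\<close>.\<close>

lemma tricomi_Psi_integral:
  assumes x: "x > 0" and z: "z \<ge> 0"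
  shows "tricomi_Psi x y z = ereal (rGamma x) * enn2ereal (laplace_nn x (y - x - 1) z)"
proof -
  have pos: "ereal (tricomi_pos x y w) = ereal (rGamma x) * enn2ereal (laplace_nn x (y - x - 1) w)"
    if "w > 0" for w
  proof -
    have "laplace_int x (y - x - 1) w \<ge> 0"
      unfolding laplace_int_def by (intro Bochner_Integration.integral_nonneg) auto
    thus ?thesis using that x
      by (simp add: tricomi_pos_eq_int tricomi_int_def laplace_nn_eq enn2ereal_ennreal)
  qed
  show ?thesis
  proof (cases "z = 0")
    case True
    have "((\<lambda>w. ereal (rGamma x) * enn2ereal (laplace_nn x (y - x - 1) w)) \<longlongrightarrow>
        ereal (rGamma x) * enn2ereal (laplace_nn x (y - x - 1) 0)) (at_right 0)"
      by (intro tendsto_cmult_ereal continuous_on_tendsto_compose[OF continuous_on_enn2ereal]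
            laplace_nn_tendsto_0) simp_all
    hence "((\<lambda>w. ereal (tricomi_pos x y w)) \<longlongrightarrow>
        ereal (rGamma x) * enn2ereal (laplace_nn x (y - x - 1) 0)) (at_right 0)"
      by (rule Lim_transform_eventually) (auto simp: pos intro!: eventually_at_rightI[of 0 1])
    thus ?thesis using True by (simp add: tricomi_Psi_def tendsto_Lim)
  next
    case False
    thus ?thesis using z pos[of z] by (simp add: tricomi_Psi_def)
  qed
qed

section \<open>The mixture density\<close>

text \<open>Finiteness of the kernel needs no hypothesis: testing the conditional law on the
  whole line forces total mass \<open>1\<close>, as \<^const>\<open>measure\<close> is \<open>0\<close> on sets of infinite mass.\<close>

lemma distributed_mixture_density:
  fixes M :: "'w measure" and X Y :: "'w \<Rightarrow> real" and g :: "real \<Rightarrow> ennreal"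
    and p :: "real \<Rightarrow> real \<Rightarrow> ennreal"
  assumes M: "prob_space M"
    and Y: "distributed M lborel Y g"
    and p [measurable]: "(\<lambda>(k, x). p k x) \<in> borel_measurable (lborel \<Otimes>\<^sub>M lborel)"
    and cond: "cond_distributed M X Y (\<lambda>k. density lborel (p k))"
  shows "distributed M lborel X (\<lambda>x. \<integral>\<^sup>+ k. g k * p k x \<partial>lborel)"
proof -
  interpret prob_space M by fact
  define K where "K k = density lborel (p k)" for k
  have X [measurable]: "X \<in> borel_measurable M" and Ym [measurable]: "Y \<in> borel_measurable M"
    using cond by (auto simp: cond_distributed_def)
  have g [measurable]: "g \<in> borel_measurable lborel"
    using Y by (simp add: distributed_def)
  define F where "F = vimage_algebra (space M) Y borel"
  have "subalgebra M F"
    unfolding subalgebra_def F_def by (auto simp: sets_vimage_algebra2)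
  interpret finite_measure_subalgebra M F
    by unfold_locales fact
  define I :: "real set \<Rightarrow> 'w \<Rightarrow> real" where "I A = indicator (X -` A \<inter> space M)" for A
  have cond': "AE \<omega> in M. real_cond_exp M F (I A) \<omega> = measure (K (Y \<omega>)) A" if "A \<in> sets borel" for A
    using cond that by (simp add: cond_distributed_def F_def I_def K_def)
  have I_int: "integrable M (I A)" if [measurable]: "A \<in> sets borel" for A
    unfolding I_def by (intro integrable_real_indicator) (auto simp: emeasure_eq_measure)
  have pk [measurable]: "p k \<in> borel_measurable borel" for k
    using measurable_Pair2[OF p, of k] by simp
  have spK [simp]: "space (K k) = UNIV" "sets (K k) = sets borel" for k
    by (simp_all add: K_def)
  have "AE \<omega> in M. real_cond_exp M F (I UNIV) \<omega> = I UNIV \<omega>"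
  proof (rule real_cond_exp_F_meas)
    have "space M \<in> sets F" using \<open>subalgebra M F\<close> by (metis sets.top subalgebra_def)
    thus "I UNIV \<in> borel_measurable F" by (simp add: I_def)
  qed (rule I_int, simp)
  hence fin: "AE \<omega> in M. emeasure (K (Y \<omega>)) UNIV \<noteq> \<infinity>"
    using cond'[of UNIV, simplified] AE_space
  proof eventually_elim
    case (elim \<omega>)
    hence "measure (K (Y \<omega>)) UNIV = 1" by (simp add: I_def)
    thus ?case by (auto simp: measure_def)
  qed
  have KA [measurable]: "(\<lambda>k. emeasure (K k) A) \<in> borel_measurable borel"
    and KA_eq: "\<And>k. emeasure (K k) A = (\<integral>\<^sup>+ x. p k x * indicator A x \<partial>lborel)"
    if [measurable]: "A \<in> sets borel" for A
  proof -
    show *: "emeasure (K k) A = (\<integral>\<^sup>+ x. p k x * indicator A x \<partial>lborel)" for k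
      unfolding K_def by (subst emeasure_density) auto
    have "(\<lambda>k. \<integral>\<^sup>+ x. p k x * indicator A x \<partial>lborel) \<in> borel_measurable lborel"
      by measurable
    thus "(\<lambda>k. emeasure (K k) A) \<in> borel_measurable borel" unfolding * by simp
  qed
  define f where "f x = (\<integral>\<^sup>+ k. g k * p k x \<partial>lborel)" for x
  have f [measurable]: "f \<in> borel_measurable lborel"
    unfolding f_def by measurable
  have main: "emeasure M (X -` A \<inter> space M) = emeasure (density lborel f) A"
    if A [measurable]: "A \<in> sets borel" for A
  proof -
    \<comment> \<open>The chain is the tower property, replacement of the conditional expectation by
      the kernel (with \<open>fin\<close> turning \<open>measure\<close> into
      \<open>emeasure\<close>), the law of \<open>Y\<close>, and Tonelli's theorem.\<close>
    have "emeasure M (X -` A \<inter> space M) = ennreal (LINT \<omega>|M. I A \<omega>)"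
      by (simp add: I_def emeasure_eq_measure)
    also have "(LINT \<omega>|M. I A \<omega>) = (LINT \<omega>|M. real_cond_exp M F (I A) \<omega>)"
      using real_cond_exp_int(2)[OF I_int[OF A]] by simp
    also have "ennreal \<dots> = (\<integral>\<^sup>+ \<omega>. ennreal (real_cond_exp M F (I A) \<omega>) \<partial>M)"
    proof (rule nn_integral_eq_integral[symmetric])
      show "AE \<omega> in M. 0 \<le> real_cond_exp M F (I A) \<omega>"
        using cond'[OF A] by eventually_elim simp
    qed (rule real_cond_exp_int(1)[OF I_int[OF A]])
    also have "\<dots> = (\<integral>\<^sup>+ \<omega>. emeasure (K (Y \<omega>)) A \<partial>M)"
    proof (rule nn_integral_cong_AE)
      show "AE \<omega> in M. ennreal (real_cond_exp M F (I A) \<omega>) = emeasure (K (Y \<omega>)) A"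
        using cond'[OF A] fin
      proof eventually_elim
        case (elim \<omega>)
        have "emeasure (K (Y \<omega>)) A \<le> emeasure (K (Y \<omega>)) UNIV"
          by (rule emeasure_mono) auto
        hence "emeasure (K (Y \<omega>)) A \<noteq> \<infinity>" using elim by (auto simp: top_unique)
        thus ?case using elim by (simp add: emeasure_eq_ennreal_measure)
      qed
    qed
    also have "\<dots> = (\<integral>\<^sup>+ k. g k * emeasure (K k) A \<partial>lborel)"
      by (rule distributed_nn_integral[OF Y, symmetric]) (simp add: KA)
    also have "\<dots> = (\<integral>\<^sup>+ k. \<integral>\<^sup>+ x. g k * p k x * indicator A x \<partial>lborel \<partial>lborel)"
      by (simp add: KA_eq mult.assoc nn_integral_cmult)
    also have "\<dots> = (\<integral>\<^sup>+ x. \<integral>\<^sup>+ k. g k * p k x * indicator A x \<partial>lborel \<partial>lborel)"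
      by (subst lborel_pair.Fubini') auto
    also have "\<dots> = (\<integral>\<^sup>+ x. f x * indicator A x \<partial>lborel)"
      unfolding f_def by (simp add: nn_integral_multc)
    also have "\<dots> = emeasure (density lborel f) A"
      by (simp add: emeasure_density)
    finally show ?thesis .
  qed
  have "distr M lborel X = density lborel f"
    by (rule measure_eqI) (use main in \<open>auto simp: emeasure_distr\<close>)
  thus ?thesis unfolding distributed_def f_def[symmetric] by simp
qed

lemma EP_scale_nonneg: "EP_scale q \<ge> 0" if "q > 0"
  using that unfolding EP_scale_def by (auto intro!: divide_nonneg_nonneg Gamma_real_nonneg)

lemma EP_density_nonneg: "EP_density q k t \<ge> 0" if "q > 0"
  using that EP_scale_nonneg[OF that] Gamma_real_pos[of "1 / q"] unfolding EP_density_def by simp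

lemma Beta_real_pos: "a > 0 \<Longrightarrow> b > 0 \<Longrightarrow> Beta a b > (0::real)"
  by (simp add: Beta_def Gamma_real_pos)

lemma G3B_density_nonneg:
  assumes "a > 0" "b > 0"
  shows "G3B_density a b \<xi> k \<ge> 0"
  using Beta_real_pos[OF assms] unfolding G3B_density_def by auto

text \<open>Under \<open>k = u / (u + \<xi>)\<close> one has \<open>k / (1 - k) = u / \<xi>\<close>,
  so the exponent of EP becomes linear in \<open>u\<close>, and
  \<open>1 - (1 - \<xi>) * k = \<xi> * (1 + u) / (u + \<xi>)\<close>. In \<open>C\<close>, the
  factor \<open>\<xi> powr (1 / q)\<close> stems from \<open>(1 / k - 1) powr (1 / q)\<close>; the
  other factors are the normalising constants of EP and G3B.\<close>

lemma nn_integral_EP_G3B: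
  assumes q: "q > 0" and a: "a > 0" and b: "b > 0" and \<xi>: "\<xi> > 0"
  defines "C \<equiv> q * EP_scale q / (2 * Gamma (1 / q) * Beta a b * \<xi> powr (1 / q))"
  shows "(\<integral>\<^sup>+ k. ennreal (EP_density q k t * G3B_density a b \<xi> k) \<partial>lborel)
           = ennreal C * laplace_nn (a + 1 / q) (- (a + b)) ((EP_scale q * \<bar>t\<bar>) powr q / \<xi>)"
proof -
  define s where "s = (EP_scale q * \<bar>t\<bar>) powr q"
  have B: "Beta a b > 0" by (rule Beta_real_pos[OF a b])
  have G: "Gamma (1 / q) > 0" using q by (intro Gamma_real_pos) auto
  have C: "C \<ge> 0" unfolding C_def using EP_scale_nonneg[OF q] q B G by simp
  define f where "f k = EP_density q k t * (1 / Beta a b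
             * (\<xi> powr a * k powr (a - 1) * (1 - k) powr (b - 1)
                 / (1 - (1 - \<xi>) * k) powr (a + b)))" for k
  have "(\<integral>\<^sup>+ k. ennreal (EP_density q k t * G3B_density a b \<xi> k) \<partial>lborel)
      = (\<integral>\<^sup>+ k. ennreal (indicator {0<..<1} k * f k) \<partial>lborel)"
    by (intro nn_integral_cong) (auto simp: G3B_density_def f_def)
  also have "\<dots> = (\<integral>\<^sup>+ u. ennreal (indicator {0<..} u * (\<xi> / (u + \<xi>)\<^sup>2 * f (u / (u + \<xi>)))) \<partial>lborel)"
  proof (rule nn_integral_Ioo_ratio[OF _ \<xi>])
    show "f \<in> borel_measurable borel"
      unfolding f_def EP_density_def by measurable
    show "f k \<ge> 0" for k
      unfolding f_def using EP_density_nonneg[OF q] B by simp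
  qed
  also have "\<dots> = (\<integral>\<^sup>+ u. ennreal (C * laplace_kernel (a + 1 / q) (- (a + b)) (s / \<xi>) u) \<partial>lborel)"
  proof (intro nn_integral_cong arg_cong[where f = ennreal])
    fix u :: real
    show "indicator {0<..} u * (\<xi> / (u + \<xi>)\<^sup>2 * f (u / (u + \<xi>)))
        = C * laplace_kernel (a + 1 / q) (- (a + b)) (s / \<xi>) u"
    proof (cases "u > 0")
      case True
      define w where "w = u + \<xi>"
      have w: "w > 0" using True \<xi> by (simp add: w_def)
      have e1: "1 / (u / w) - 1 = \<xi> / u" and e2: "1 - u / w = \<xi> / w"
        and e3: "1 - (1 - \<xi>) * (u / w) = \<xi> * (1 + u) / w"
        using True w by (simp_all add: w_def field_simps)
      have e4: "u / w * s / (\<xi> / w) = s / \<xi> * u"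
        using w \<xi> by (simp add: field_simps)
      have EP: "EP_density q (u / w) t
          = q * EP_scale q / (2 * Gamma (1 / q) * \<xi> powr (1 / q)) * u powr (1 / q) * exp (- (s / \<xi> * u))"
        unfolding EP_density_def e1 e2 s_def[symmetric] e4
        using True \<xi> by (simp add: powr_divide mult_ac)
      \<comment> \<open>With the Jacobian contributing \<open>w\<^sup>2\<close>, all powers of
        \<open>w = u + \<xi>\<close> cancel; by \<open>xp\<close> so do those of
        \<open>\<xi>\<close> in the G3B part.\<close>
      have wp: "w powr (a + b) = w powr (a - 1) * w powr (b - 1) * w\<^sup>2"
        using w by (simp flip: powr_add powr_numeral)
      have xp: "\<xi> * \<xi> powr a * \<xi> powr (b - 1) = \<xi> powr (a + b)"
        using \<xi> by (simp add: powr_mult_base flip: powr_add)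
      have "\<xi> / w\<^sup>2 * (\<xi> powr a * (u / w) powr (a - 1) * (\<xi> / w) powr (b - 1)
                 / (\<xi> * (1 + u) / w) powr (a + b))
          = (\<xi> * \<xi> powr a * \<xi> powr (b - 1)) * u powr (a - 1) * w powr (a + b)
             / ((w powr (a - 1) * w powr (b - 1) * w\<^sup>2) * \<xi> powr (a + b) * (1 + u) powr (a + b))"
        using True \<xi> w by (simp add: powr_divide powr_mult mult_ac)
      also have "\<dots> = u powr (a - 1) * (1 + u) powr (- (a + b))"
        unfolding wp[symmetric] xp using w \<xi> True by (simp add: powr_minus_divide del: minus_add_distrib)
      finally have G3B: "\<xi> / w\<^sup>2 * (\<xi> powr a * (u / w) powr (a - 1) * (\<xi> / w) powr (b - 1)
                 / (\<xi> * (1 + u) / w) powr (a + b)) = u powr (a - 1) * (1 + u) powr (- (a + b))" .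
      have up: "u powr (a + 1 / q - 1) = u powr (1 / q) * u powr (a - 1)"
        by (simp add: algebra_simps flip: powr_add)
      have "\<xi> / w\<^sup>2 * f (u / w) = EP_density q (u / w) t / Beta a b
          * (\<xi> / w\<^sup>2 * (\<xi> powr a * (u / w) powr (a - 1) * (\<xi> / w) powr (b - 1)
                 / (\<xi> * (1 + u) / w) powr (a + b)))"
        unfolding f_def e2 e3 by (simp add: mult_ac)
      also have "\<dots> = C * (u powr (a + 1 / q - 1) * (1 + u) powr (- (a + b)) * exp (- (s / \<xi> * u)))"
        unfolding G3B EP up C_def by (simp add: mult_ac)
      finally show ?thesis using True by (simp add: laplace_kernel_def w_def)
    qed (simp add: laplace_kernel_def)
  qed
  also have "\<dots> = ennreal C * laplace_nn (a + 1 / q) (- (a + b)) (s / \<xi>)"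
    unfolding laplace_nn_def using C by (simp add: ennreal_mult nn_integral_cmult)
  finally show ?thesis unfolding s_def .
qed

text \<open>With \<open>x = a + 1/q\<close> and \<open>y = 1 + 1/q - b\<close> the exponent
  \<open>y - x - 1\<close> is \<open>- (a + b)\<close>, and the \<open>rGamma x\<close> of the
  integral representation cancels the \<open>Gamma (a + 1/q)\<close> of the claimed density.\<close>

lemma EP_G3B_density_eq_nn_integral:
  assumes q: "q > 0" and a: "a > 0" and b: "b > 0" and \<xi>: "\<xi> > 0"
  shows "enn2ereal (\<integral>\<^sup>+ k. ennreal (EP_density q k t * G3B_density a b \<xi> k) \<partial>lborel)
           = EP_G3B_density q a b \<xi> t"
proof -
  let ?z = "(EP_scale q * \<bar>t\<bar>) powr q / \<xi>"
  define C where "C = q * EP_scale q / (2 * Gamma (1 / q) * Beta a b * \<xi> powr (1 / q))"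
  have C: "C \<ge> 0"
    unfolding C_def using EP_scale_nonneg[OF q] q Beta_real_pos[OF a b] Gamma_real_pos[of "1 / q"] by simp
  have x: "a + 1 / q > 0" using a q by (simp add: add_pos_pos)
  have "tricomi_Psi (a + 1 / q) (1 + 1 / q - b) ?z
      = ereal (rGamma (a + 1 / q)) * enn2ereal (laplace_nn (a + 1 / q) (- (a + b)) ?z)"
    using tricomi_Psi_integral[OF x, of ?z "1 + 1 / q - b"] \<xi> by (simp add: algebra_simps)
  hence "EP_G3B_density q a b \<xi> t
      = ereal (Gamma (a + 1 / q) / Gamma (1 / q) * (q / (2 * Beta a b)) * (EP_scale q / \<xi> powr (1 / q))
                * rGamma (a + 1 / q)) * enn2ereal (laplace_nn (a + 1 / q) (- (a + b)) ?z)"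
    unfolding EP_G3B_density_def by (simp flip: mult.assoc)
  also have "Gamma (a + 1 / q) / Gamma (1 / q) * (q / (2 * Beta a b)) * (EP_scale q / \<xi> powr (1 / q))
                * rGamma (a + 1 / q) = C"
    unfolding C_def rGamma_inverse_Gamma using Gamma_real_pos[OF x] by (simp add: field_simps)
  also have "ereal C * enn2ereal (laplace_nn (a + 1 / q) (- (a + b)) ?z)
      = enn2ereal (ennreal C * laplace_nn (a + 1 / q) (- (a + b)) ?z)"
    using C by (simp add: times_ennreal.rep_eq enn2ereal_ennreal)
  finally show ?thesis unfolding nn_integral_EP_G3B[OF assms] C_def ..
qed

text \<open>Being a density determines a function only almost everywhere; the second conjunct
  therefore identifies the mixture integral at every point, including a possible value infinity at
  0.\<close>

theorem theorem1:
  fixes M :: "'w measure" and \<theta> \<kappa> :: "'w \<Rightarrow> real" and q a b \<xi> :: real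
  assumes "prob_space M"
    and "q > 0" and "a > 0" and "b > 0" and "\<xi> > 0"
    and "distributed M lborel \<kappa> (\<lambda>k. ennreal (G3B_density a b \<xi> k))"
    and "cond_distributed M \<theta> \<kappa> (EP q)"
  shows "distributed M lborel \<theta> (\<lambda>t. e2ennreal (EP_G3B_density q a b \<xi> t))
    \<and> (\<forall>t. enn2ereal (\<integral>\<^sup>+ k. ennreal (EP_density q k t * G3B_density a b \<xi> k) \<partial>lborel)
             = EP_G3B_density q a b \<xi> t)"
proof -
  have eq: "enn2ereal (\<integral>\<^sup>+ k. ennreal (EP_density q k t * G3B_density a b \<xi> k) \<partial>lborel)
             = EP_G3B_density q a b \<xi> t" for t
    using assms(2-5) by (rule EP_G3B_density_eq_nn_integral)
  have "distributed M lborel \<theta>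
      (\<lambda>t. \<integral>\<^sup>+ k. ennreal (G3B_density a b \<xi> k) * ennreal (EP_density q k t) \<partial>lborel)"
  proof (rule distributed_mixture_density[OF assms(1,6)])
    show "(\<lambda>(k, x). ennreal (EP_density q k x)) \<in> borel_measurable (lborel \<Otimes>\<^sub>M lborel)"
      unfolding EP_density_def by measurable
    show "cond_distributed M \<theta> \<kappa> (\<lambda>k. density lborel (\<lambda>x. ennreal (EP_density q k x)))"
      using assms(7) by (simp add: EP_def[abs_def])
  qed
  moreover have "(\<integral>\<^sup>+ k. ennreal (G3B_density a b \<xi> k) * ennreal (EP_density q k t) \<partial>lborel)
      = e2ennreal (EP_G3B_density q a b \<xi> t)" for t
    unfolding eq[symmetric] using assms(2-4)
    by (simp add: EP_density_nonneg G3B_density_nonneg mult.commute flip: ennreal_mult)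
  ultimately show ?thesis using eq by simp
qed

end
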